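(* Fix positive integers $L$ and $R$. Let $F_1(x,q,r,s,t)=\sum_w x^{m(w)}q^{\ell(w)}r^{\alpha(w)}s^{\beta(w)}t^{\gamma(w)}$, where the sum is over all $(L)(M)(R)$-words $w$ (over all $M\ge1$) that have at least two $M$-descents and at least one $M$-letter to the right of the leftmost $R$-letter. Let $F_0(x,q,r)=\sum_w x^{m(w)}q^{\ell(w)}r^{\alpha(w)}$, the sum over all $(L)(M)(R)$-words with at least two $M$-descents and no $M$-letter to the right of the leftmost $R$-letter. Then, suppressing $x$ and $q$ in the notation, $$F_1(r,s,t)=E_1(r,s,t)+\frac{x}{1-qr}F_1(1,s,qt)-\frac{xqr}{1-qr}F_1(qr,s,qt)-\frac{xt(qs)^{R+1}}{1-qs}F_1(r,1,t)+\frac{xt}{1-qs}F_1(r,qs,t),$$ where $$E_1(r,s,t)=xt\Big(\sum_{b=1}^R(qs)^b\Big)F_0(r)+\sum_{m\ge0}\sum_{i=1}^{m-1}x^{m+1}\binom{L+i}{L}_q\left(\binom{m}{i}_q-1\right)\left(\sum_{k=1}^{m-i-1}\sum_{c=1}^{k}\sum_{b=1}^{R}q^{k+b+c-1}r^{k-c}s^bt^c\binom{b+c-2}{b-1}_q\right).$$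
   Context: For positive integers $L,M,R$, an $(L)(M)(R)$-word is a permutation of $\{1,\dots,L+M+R\}$ that is $321$-avoiding (no positions $i<j<k$ with $w_i>w_j>w_k$), in which the numbers $1,\dots,L$ appear in increasing order, the numbers $L+M+1,\dots,L+M+R$ appear in increasing order, and every number in $\{1,\dots,L\}$ appears to the left of every number in $\{L+M+1,\dots,L+M+R\}$. Entries in $\{1,\dots,L\}$ are called $L$-letters, those in $\{L+1,\dots,L+M\}$ $M$-letters, and those in $\{L+M+1,\dots,L+M+R\}$ $R$-letters. The word has an $M$-descent in position $i$ if the $i$-th $M$-letter (from the left) is larger than the $(i+1)$-st $M$-letter. Statistics: $m(w)=M$; $\ell(w)$ is the number of inversions (pairs of positions $i<j$ with $w_i>w_j$); $\alpha(w)$ is the number of $M$-letters after the last $M$-descent and before the leftmost $R$-letter; $\beta(w)$ is the number of $R$-letters before the last $M$-letter; $\gamma(w)$ is the number of $M$-letters to the right of the leftmost $R$-letter. The $q$-binomial coefficient is $\binom{n}{k}_q=\frac{(1-q^n)(1-q^{n-1})\cdots(1-q^{n-k+1})}{(1-q^k)(1-q^{k-1})\cdots(1-q)}$. *)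

theory Defs
  imports
    "HOL-Computational_Algebra.Computational_Algebra"
    "HOL-Combinatorics.Multiset_Permutations"
begin

definition L_letter :: "nat \<Rightarrow> nat \<Rightarrow> bool" where
  "L_letter L a \<longleftrightarrow> a \<in> {1..L}"

definition M_letter :: "nat \<Rightarrow> nat \<Rightarrow> nat \<Rightarrow> bool" where
  "M_letter L M a \<longleftrightarrow> a \<in> {L+1..L+M}"

definition R_letter :: "nat \<Rightarrow> nat \<Rightarrow> nat \<Rightarrow> nat \<Rightarrow> bool" where
  "R_letter L M R a \<longleftrightarrow> a \<in> {L+M+1..L+M+R}"

definition avoids_321 :: "nat list \<Rightarrow> bool" where
  "avoids_321 w \<longleftrightarrow> \<not> (\<exists>i j k. i < j \<and> j < k \<and> k < length w \<and> w ! i > w ! j \<and> w ! j > w ! k)"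

(* Permutations of {1..n} are represented in one-line notation, as lists;
   list positions start at 0. *)
definition LMR_words :: "nat \<Rightarrow> nat \<Rightarrow> nat \<Rightarrow> nat list set" where
  "LMR_words L M R =
     {w \<in> permutations_of_set {1..L+M+R}.
        avoids_321 w
      \<and> (\<forall>i j. i < j \<and> j < length w \<and> L_letter L (w ! i) \<and> L_letter L (w ! j) \<longrightarrow> w ! i < w ! j)
      \<and> (\<forall>i j. i < j \<and> j < length w \<and> R_letter L M R (w ! i) \<and> R_letter L M R (w ! j) \<longrightarrow> w ! i < w ! j)
      \<and> (\<forall>i j. i < length w \<and> j < length w \<and> L_letter L (w ! i) \<and> R_letter L M R (w ! j) \<longrightarrow> i < j)}"

definition M_subword :: "nat \<Rightarrow> nat \<Rightarrow> nat list \<Rightarrow> nat list" where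
  "M_subword L M w = filter (M_letter L M) w"

(* M-descents are numbered from 1: the i-th M-letter is the list entry with index i - 1. *)
definition M_descents :: "nat \<Rightarrow> nat \<Rightarrow> nat list \<Rightarrow> nat set" where
  "M_descents L M w =
     {i. 1 \<le> i \<and> i < length (M_subword L M w) \<and> M_subword L M w ! (i - 1) > M_subword L M w ! i}"

definition inversions :: "nat list \<Rightarrow> nat" where
  "inversions w = card {(i, j). i < j \<and> j < length w \<and> w ! i > w ! j}"

definition leftmost_R :: "nat \<Rightarrow> nat \<Rightarrow> nat \<Rightarrow> nat list \<Rightarrow> nat" where
  "leftmost_R L M R w = (LEAST p. p < length w \<and> R_letter L M R (w ! p))"

definition last_M :: "nat \<Rightarrow> nat \<Rightarrow> nat list \<Rightarrow> nat" where
  "last_M L M w = (GREATEST p. p < length w \<and> M_letter L M (w ! p))"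

(* The M-letter at position p is the i-th M-letter for
   i = length (M_subword L M (take (Suc p) w)); it comes after an M-descent in
   position d iff i > d. Only used for words that have an M-descent. *)
definition alpha :: "nat \<Rightarrow> nat \<Rightarrow> nat \<Rightarrow> nat list \<Rightarrow> nat" where
  "alpha L M R w =
     card {p. p < length w \<and> M_letter L M (w ! p)
            \<and> length (M_subword L M (take (Suc p) w)) > Max (M_descents L M w)
            \<and> p < leftmost_R L M R w}"

definition beta :: "nat \<Rightarrow> nat \<Rightarrow> nat \<Rightarrow> nat list \<Rightarrow> nat" where
  "beta L M R w = card {p. p < length w \<and> R_letter L M R (w ! p) \<and> p < last_M L M w}"

definition gamma :: "nat \<Rightarrow> nat \<Rightarrow> nat \<Rightarrow> nat list \<Rightarrow> nat" where
  "gamma L M R w = card {p. p < length w \<and> M_letter L M (w ! p) \<and> p > leftmost_R L M R w}"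

definition words1 :: "nat \<Rightarrow> nat \<Rightarrow> nat \<Rightarrow> nat list set" where
  "words1 L M R = {w \<in> LMR_words L M R. card (M_descents L M w) \<ge> 2
     \<and> (\<exists>p < length w. M_letter L M (w ! p) \<and> p > leftmost_R L M R w)}"

definition words0 :: "nat \<Rightarrow> nat \<Rightarrow> nat \<Rightarrow> nat list set" where
  "words0 L M R = {w \<in> LMR_words L M R. card (M_descents L M w) \<ge> 2
     \<and> \<not> (\<exists>p < length w. M_letter L M (w ! p) \<and> p > leftmost_R L M R w)}"

(* The generating functions are formal power series in x. For fixed L, M, R there are
   only finitely many words, so the coefficient of x^M is a polynomial in q, r, s, t.
   These four are arguments ranging over an arbitrary commutative ring, so that
   substitutions such as F1(1, s, qt) are plain function application. *)
definition F1 :: "nat \<Rightarrow> nat \<Rightarrow> 'a \<Rightarrow> 'a \<Rightarrow> 'a \<Rightarrow> 'a \<Rightarrow> 'a :: comm_ring_1 fps" where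
  "F1 L R q r s t = Abs_fps (\<lambda>M. if M \<ge> 1 then
     (\<Sum>w\<in>words1 L M R. q ^ inversions w * r ^ alpha L M R w * s ^ beta L M R w * t ^ gamma L M R w)
     else 0)"

definition F0 :: "nat \<Rightarrow> nat \<Rightarrow> 'a \<Rightarrow> 'a \<Rightarrow> 'a :: comm_ring_1 fps" where
  "F0 L R q r = Abs_fps (\<lambda>M. if M \<ge> 1 then
     (\<Sum>w\<in>words0 L M R. q ^ inversions w * r ^ alpha L M R w)
     else 0)"

(* Only meaningful if q^j \<noteq> 1 for 1 \<le> j \<le> k. *)
definition qbinomial :: "'a :: field \<Rightarrow> nat \<Rightarrow> nat \<Rightarrow> 'a" where
  "qbinomial q n k = (\<Prod>j<k. 1 - q ^ (n - j)) / (\<Prod>j=1..k. 1 - q ^ j)"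

(* All subtractions on nat below are exact within the summation ranges. *)
definition E1 :: "nat \<Rightarrow> nat \<Rightarrow> 'a \<Rightarrow> 'a \<Rightarrow> 'a \<Rightarrow> 'a \<Rightarrow> 'a :: field fps" where
  "E1 L R q r s t =
     fps_X * fps_const (t * (\<Sum>b=1..R. (q * s) ^ b)) * F0 L R q r
   + fps_X * Abs_fps (\<lambda>m. \<Sum>i=1..m-1.
       qbinomial q (L + i) L * (qbinomial q m i - 1)
       * (\<Sum>k=1..m-i-1. \<Sum>c=1..k. \<Sum>b=1..R.
            q ^ (k + b + c - 1) * r ^ (k - c) * s ^ b * t ^ c * qbinomial q (b + c - 2) (b - 1)))"

(* An identity over every field and for all q, r, s, t subject to the conditions below
   contains the identity in indeterminates: the variables of the rational function field
   in q, r, s, t satisfy these conditions. *)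
lemma indeterminates_admissible:
  fixes q r s t :: "rat poly poly poly poly fract"
  defines "q \<equiv> Fract [:0, 1:] 1"
    and "r \<equiv> Fract [:[:0, 1:]:] 1"
    and "s \<equiv> Fract [:[:[:0, 1:]:]:] 1"
    and "t \<equiv> Fract [:[:[:[:0, 1:]:]:]:] 1"
  shows "\<forall>n>0. q ^ n \<noteq> 1" "q * r \<noteq> 1" "q * s \<noteq> 1"
proof -
  have pow: "q ^ n = Fract ([:0, 1:] ^ n) 1" for n
    by (induction n) (simp_all add: q_def One_fract_def)
  have "[:0, 1:] ^ n \<noteq> (1 :: rat poly poly poly poly)" if "n > 0" for n :: nat
  proof
    assume eq: "[:0, 1:] ^ n = (1 :: rat poly poly poly poly)"
    have "degree ([:0, 1:] ^ n :: rat poly poly poly poly) = n"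
      by (simp add: degree_power_eq)
    with eq that show False by simp
  qed
  then show "\<forall>n>0. q ^ n \<noteq> 1"
    by (simp add: pow One_fract_def eq_fract)
  show "q * r \<noteq> 1" "q * s \<noteq> 1"
    by (simp_all add: q_def r_def s_def One_fract_def eq_fract one_pCons)
qed

end

(* Put N = L + M. Deleting the R-letters of a word leaves a 321-avoiding permutation p of {1..N} with
   increasing L-letters, and 321-avoidance forces everything after the last descent of its M-letters to
   be an increasing run of M-letters. The word is recovered from p, the number c of M-letters to the
   right of N+1 (at most the length A of that run), the number b of R-letters before the last M-letter,
   and a shuffle of c-1 M-letters with b-1 R-letters. Hence F1 is the sum over p, weighted by
   q^inversions, of
     f(A) = sum_{c=1..A} r^(A-c) t^c H_c(s),  H_c(s) = sum_{b=1..R} s^b q^(b+c-1) [b+c-2, b-1]_q,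
   and F0 is the same sum with r^A.

   Deleting the largest letter of p gives a recursion in M. If k letters stand to its right, they form
   an increasing run: k = 0 turns A into A+1, while k > 0 makes k the new A, with 1 <= k <= A when the
   smaller word has two descents and 1 <= k < A when it has exactly one. The words with exactly one
   descent yield the double sum in E1. The term f(A+1) yields the F0 part of E1 and the two
   last terms by the q-Pascal rule in the form (1 - qs) H_(c+1)(s) = H_c(qs) - (qs)^(R+1) H_c(1), and
   sum_{k=1..A} q^k f(k) yields the other two by summing geometric series. *)
theory Submission
  imports Defs
begin


section \<open>Lists avoiding 321 and their inversions\<close>

text \<open>All copies of F1 in the equation are sums over the same words p with different weights
  f(A). So it is enough to have one recursion for arbitrary f and then an identity between the
  weights for each single A. This works because A carries all that matters: a largest letter
  inserted with k letters to its right adds k inversions to any word, and A together with the number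
  of descents, capped at two, decides whether it may go there and which run results. The obstacle is
  that the words with at least two descents are not closed under deletion of the largest letter. A
  letter inserted inside the last run adds a descent; inserted right before that run it takes over
  the descent already there. So a word with one descent enters for k < A only, and a word without
  descents never. Words whose only descent is in position i can be listed outright: the i-subset of
  M-letters before the descent accounts for the q-binomial of m and i, less 1 for the initial
  interval, which produces no descent, and the L-letters shuffled with it for the other q-binomial.
  There A = m - i, whence the bound m - i - 1 on k.\<close>

lemma sorted_wrt_filter_iff_nth:
  "sorted_wrt Q (filter P xs) \<longleftrightarrow>
     (\<forall>i j. i < j \<and> j < length xs \<and> P (xs ! i) \<and> P (xs ! j) \<longrightarrow> Q (xs ! i) (xs ! j))"
proof (induction xs)
  case (Cons x xs)
  have "(\<forall>i j. i < j \<and> j < length (x # xs) \<and> P ((x # xs) ! i) \<and> P ((x # xs) ! j)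
          \<longrightarrow> Q ((x # xs) ! i) ((x # xs) ! j)) \<longleftrightarrow>
        (\<forall>j < length xs. P x \<and> P (xs ! j) \<longrightarrow> Q x (xs ! j)) \<and>
        (\<forall>i j. i < j \<and> j < length xs \<and> P (xs ! i) \<and> P (xs ! j) \<longrightarrow> Q (xs ! i) (xs ! j))"
    (is "?l \<longleftrightarrow> ?r1 \<and> ?r2")
  proof (intro iffI conjI)
    assume l: ?l
    show ?r1 using l[rule_format, of 0 "Suc j" for j] by auto
    show ?r2 using l[rule_format, of "Suc i" "Suc j" for i j] by auto
  next
    assume r: "?r1 \<and> ?r2"
    show ?l
    proof (intro allI impI)
      fix i j
      assume a: "i < j \<and> j < length (x # xs) \<and> P ((x # xs) ! i) \<and> P ((x # xs) ! j)"
      then obtain j' where j: "j = Suc j'" by (cases j) auto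
      show "Q ((x # xs) ! i) ((x # xs) ! j)"
        using a r j by (cases i) auto
    qed
  qed
  moreover have "(\<forall>y\<in>set xs. P x \<and> P y \<longrightarrow> Q x y) \<longleftrightarrow> ?r1"
    by (simp add: all_set_conv_all_nth)
  ultimately show ?case using Cons.IH by auto
qed simp

lemma avoids_321_Nil [simp]: "avoids_321 []"
  by (simp add: avoids_321_def)

text \<open>A 321 pattern that starts at \<open>x\<close> is an inversion among the later letters
  below \<open>x\<close>. With this recursion pattern avoidance is handled by list induction instead
  of triples of positions.\<close>

lemma avoids_321_Cons:
  "avoids_321 (x # xs) \<longleftrightarrow> avoids_321 xs \<and> sorted (filter (\<lambda>y. y < x) xs)"
proof -
  have "avoids_321 (x # xs) \<longleftrightarrow> avoids_321 xs \<and>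
      (\<forall>i j. i < j \<and> j < length xs \<and> xs ! i < x \<and> xs ! j < x \<longrightarrow> xs ! i \<le> xs ! j)"
    (is "?l \<longleftrightarrow> ?r1 \<and> ?r2")
  proof (intro iffI conjI)
    assume l: ?l
    show ?r1
      unfolding avoids_321_def
    proof clarify
      fix i j k assume "i < j" "j < k" "k < length xs" "xs ! i > xs ! j" "xs ! j > xs ! k"
      then have "Suc i < Suc j \<and> Suc j < Suc k \<and> Suc k < length (x # xs) \<and>
        (x # xs) ! Suc i > (x # xs) ! Suc j \<and> (x # xs) ! Suc j > (x # xs) ! Suc k" by simp
      with l show False unfolding avoids_321_def by blast
    qed
    show ?r2
    proof (intro allI impI, rule ccontr)
      fix i j
      assume "i < j \<and> j < length xs \<and> xs ! i < x \<and> xs ! j < x" "\<not> xs ! i \<le> xs ! j"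
      then have "0 < Suc i \<and> Suc i < Suc j \<and> Suc j < length (x # xs) \<and>
        (x # xs) ! 0 > (x # xs) ! Suc i \<and> (x # xs) ! Suc i > (x # xs) ! Suc j" by simp
      with l show False unfolding avoids_321_def by blast
    qed
  next
    assume r: "?r1 \<and> ?r2"
    show ?l
      unfolding avoids_321_def
    proof clarify
      fix i j k
      assume a: "i < j" "j < k" "k < length (x # xs)" "(x # xs) ! i > (x # xs) ! j"
        "(x # xs) ! j > (x # xs) ! k"
      then obtain j' k' where jk: "j = Suc j'" "k = Suc k'" by (cases j; cases k) auto
      show False
      proof (cases i)
        case 0
        then have "j' < k' \<and> k' < length xs \<and> xs ! j' < x \<and> xs ! k' < x" "\<not> xs ! j' \<le> xs ! k'"
          using a jk by auto
        then show False using r by blast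
      next
        case (Suc i')
        then have "i' < j' \<and> j' < k' \<and> k' < length xs \<and> xs ! i' > xs ! j' \<and> xs ! j' > xs ! k'"
          using a jk by auto
        then show False using r unfolding avoids_321_def by blast
      qed
    qed
  qed
  then show ?thesis by (simp add: sorted_wrt_filter_iff_nth)
qed

lemma inversions_Nil [simp]: "inversions [] = 0"
  by (simp add: inversions_def)

lemma inversions_Cons [simp]:
  "inversions (x # xs) = length (filter (\<lambda>y. y < x) xs) + inversions xs"
proof -
  have "{(i, j). i < j \<and> j < length (x # xs) \<and> (x # xs) ! i > (x # xs) ! j} =
      (\<lambda>j. (0, Suc j)) ` {j. j < length xs \<and> xs ! j < x} \<union>
      map_prod Suc Suc ` {(i, j). i < j \<and> j < length xs \<and> xs ! i > xs ! j}" (is "?A = ?B \<union> ?C")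
  proof (intro equalityI subsetI)
    fix p assume "p \<in> ?A"
    then obtain i j where p: "p = (i, j)" "i < j" "j < length (x # xs)"
      "(x # xs) ! i > (x # xs) ! j" by auto
    then obtain j' where "j = Suc j'" by (cases j) auto
    with p show "p \<in> ?B \<union> ?C" by (cases i) (auto simp: image_iff)
  qed auto
  moreover have "finite {(i, j). i < j \<and> j < length xs \<and> xs ! i > xs ! j}"
    by (rule finite_subset[of _ "{..<length xs} \<times> {..<length xs}"]) auto
  moreover have "?B \<inter> ?C = {}" by auto
  ultimately have "inversions (x # xs) = card ?B + card ?C"
    unfolding inversions_def by (simp only: card_Un_disjoint finite_imageI) (simp add: card_Un_disjoint)
  also have "card ?B = length (filter (\<lambda>y. y < x) xs)"
    by (subst card_image) (auto simp: inj_on_def length_filter_conv_card)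
  also have "card ?C = inversions xs"
    by (subst card_image) (auto simp: inversions_def inj_on_def)
  finally show ?thesis .
qed

lemma inversions_append:
  "inversions (xs @ ys) =
     inversions xs + inversions ys + (\<Sum>x\<leftarrow>xs. length (filter (\<lambda>y. y < x) ys))"
  by (induction xs) auto

lemma inversions_sorted: "sorted xs \<Longrightarrow> inversions xs = 0"
  by (induction xs) (auto simp: filter_empty_conv)

lemma inversions_insert_greater:
  assumes "\<forall>x\<in>set (u @ v). x < n"
  shows "inversions (u @ n # v) = inversions (u @ v) + length v"
  using assms by (induction u) (auto simp: filter_True[of v "\<lambda>y. y < n"] not_less less_imp_le)

text \<open>A letter above all others can only be the 3 of a pattern, so only the letters behind it
  are constrained.\<close>

lemma avoids_321_insert_greater:
  assumes "\<forall>x\<in>set (u @ v). x < n"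
  shows "avoids_321 (u @ n # v) \<longleftrightarrow> avoids_321 (u @ v) \<and> sorted v"
  using assms
proof (induction u)
  case (Cons x u)
  then have "\<not> n < x" by auto
  with Cons show ?case by (auto simp: avoids_321_Cons)
qed (auto simp: avoids_321_Cons)

lemma avoids_321_filter: "avoids_321 xs \<Longrightarrow> avoids_321 (filter P xs)"
proof (induction xs)
  case (Cons x xs)
  have "filter (\<lambda>y. y < x) (filter P xs) = filter P (filter (\<lambda>y. y < x) xs)"
    by (simp add: conj_commute)
  with Cons show ?case by (auto simp: avoids_321_Cons simp del: filter_filter intro: sorted_wrt_filter)
qed simp

lemma avoids_321_appendD:
  assumes "avoids_321 (u @ v)" shows "avoids_321 v"
  using assms by (induction u) (auto simp: avoids_321_Cons)

text \<open>Used to put R-letters back into a word. The letters of \<open>u\<close> are at most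
  \<open>N\<close> and have only small letters of \<open>v\<close> below them; inside
  \<open>v\<close> two of any three letters lie in the same increasing half.\<close>

lemma avoids_321_appendI:
  fixes N :: nat
  assumes "\<forall>x\<in>set u. x \<le> N" "avoids_321 (u @ filter (\<lambda>x. x \<le> N) v)"
    "sorted (filter (\<lambda>x. x \<le> N) v)" "sorted (filter (\<lambda>x. \<not> x \<le> N) v)"
  shows "avoids_321 (u @ v)"
  using assms(1,2)
proof (induction u)
  case Nil
  show ?case using assms(3,4)
  proof (simp, induction v)
    case (Cons x v)
    have "sorted (filter (\<lambda>y. y < x) v)"
    proof (cases "x \<le> N")
      case True
      then have "filter (\<lambda>y. y < x) v = filter (\<lambda>y. y < x) (filter (\<lambda>x. x \<le> N) v)"
        by (auto intro: filter_cong)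
      then show ?thesis using Cons.prems True by (simp add: sorted_wrt_filter del: filter_filter)
    next
      case False
      then have "filter (\<lambda>y. y < x) v = filter (\<lambda>x. x \<le> N) v"
        using Cons.prems by (intro filter_cong) auto
      then show ?thesis using Cons.prems False by simp
    qed
    with Cons show ?case by (auto simp: avoids_321_Cons split: if_splits)
  qed simp
next
  case (Cons x u)
  have "filter (\<lambda>y. y < x) v = filter (\<lambda>y. y < x) (filter (\<lambda>x. x \<le> N) v)"
    using Cons.prems by (auto intro!: filter_cong)
  with Cons show ?case by (simp add: avoids_321_Cons)
qed


section \<open>Inserting a new largest letter\<close>

text \<open>Numbered from 1 as in \<open>M_descents\<close>, so that a descent \<open>d\<close> is
  the length of the prefix before the break: \<open>take d xs\<close> ends with its top and
  \<open>drop d xs\<close> starts with its bottom.\<close>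

definition descents :: "nat list \<Rightarrow> nat set" where
  "descents xs = {i. 1 \<le> i \<and> i < length xs \<and> xs ! (i - 1) > xs ! i}"

lemma finite_descents [simp]: "finite (descents xs)"
  by (rule finite_subset[of _ "{..<length xs}"]) (auto simp: descents_def)

lemma descents_less_length: "d \<in> descents xs \<Longrightarrow> d < length xs"
  by (simp add: descents_def)

lemma descents_appendI:
  "i < length U \<Longrightarrow> i \<in> descents (U @ V) \<longleftrightarrow> i \<in> descents U"
  by (auto simp: descents_def nth_append)

lemma descents_append_sorted:
  assumes "sorted V" "i \<in> descents (U @ V)"
  shows "i \<le> length U"
proof (rule ccontr)
  assume "\<not> i \<le> length U"
  then obtain j where "i = length U + Suc j" by (metis less_imp_Suc_add not_le add_Suc_right)
  then have "V ! j > V ! Suc j" "Suc j < length V"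
    using assms(2) by (auto simp: descents_def nth_append)
  with assms(1) show False by (simp add: sorted_iff_nth_Suc leD)
qed

text \<open>A descent across the boundary of \<open>U\<close> and \<open>V\<close> disappears,
  because \<open>n\<close> now follows \<open>U\<close>, and a new one arises behind
  \<open>n\<close>. Hence the number of descents need not grow.\<close>

lemma descents_insert_greater:
  assumes "sorted V" "V \<noteq> []" "\<forall>x\<in>set (U @ V). x < n"
  shows "descents (U @ n # V) = insert (length U + 1) (descents U)"
proof (intro equalityI subsetI)
  fix i assume i: "i \<in> descents (U @ n # V)"
  then have "i \<le> length U + 1"
    using descents_append_sorted[of V i "U @ [n]"] assms(1) by simp
  moreover have "i \<noteq> length U"
  proof
    assume "i = length U"
    with i have "U ! (length U - 1) > n" "U \<noteq> []"
      by (auto simp: descents_def nth_append split: if_splits)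
    moreover from \<open>U \<noteq> []\<close> have "U ! (length U - 1) \<in> set U" by (intro nth_mem) simp
    ultimately show False using assms(3) by (metis Un_iff less_asym set_append)
  qed
  ultimately have "i = length U + 1 \<or> i < length U" by linarith
  with i show "i \<in> insert (length U + 1) (descents U)"
    by (auto simp: descents_appendI)
next
  fix i assume "i \<in> insert (length U + 1) (descents U)"
  then show "i \<in> descents (U @ n # V)"
  proof
    assume "i = length U + 1"
    moreover from assms have "V ! 0 < n" by (cases V) auto
    ultimately show ?thesis using assms by (simp add: descents_def nth_append)
  next
    assume "i \<in> descents U"
    then show ?thesis using descents_appendI[of i U "n # V"] descents_less_length by blast
  qed
qed

lemma descents_snoc_greater:
  assumes "\<forall>x\<in>set U. x < n"
  shows "descents (U @ [n]) = descents U"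
proof -
  have "i \<noteq> length U" if i: "i \<in> descents (U @ [n])" for i
  proof
    assume "i = length U"
    with i have "U ! (length U - 1) > n" "U \<noteq> []"
      by (auto simp: descents_def nth_append split: if_splits)
    moreover from \<open>U \<noteq> []\<close> have "U ! (length U - 1) \<in> set U" by (intro nth_mem) simp
    ultimately show False using assms by fastforce
  qed
  then show ?thesis
    using descents_appendI[of _ U "[n]"] descents_less_length[of _ U]
      descents_less_length[of _ "U @ [n]"] by (fastforce simp: less_Suc_eq)
qed

lemma sorted_drop_Max_descents:
  assumes "descents xs \<noteq> {}"
  shows "sorted (drop (Max (descents xs)) xs)"
  unfolding sorted_iff_nth_Suc
proof (intro allI impI, rule ccontr)
  fix i
  let ?d = "Max (descents xs)"
  assume i: "Suc i < length (drop ?d xs)"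
    "\<not> drop ?d xs ! i \<le> drop ?d xs ! Suc i"
  then have "?d + Suc i \<in> descents xs" by (auto simp: descents_def)
  then have "?d + Suc i \<le> ?d" by (intro Max_ge) auto
  then show False by simp
qed

lemma filter_eq_appendE:
  assumes "filter P w = a @ b"
  obtains u v where "w = u @ v" "filter P u = a" "filter P v = b"
  using assms
proof (induction w arbitrary: a thesis)
  case (Cons x w)
  show ?case
  proof (cases "P x \<and> a \<noteq> []")
    case True
    then obtain a' where "a = x # a'" "filter P w = a' @ b" using Cons.prems(2) by (cases a) auto
    then obtain u v where "w = u @ v" "filter P u = a'" "filter P v = b" using Cons.IH by blast
    with True \<open>a = x # a'\<close> show ?thesis using Cons.prems(1)[of "x # u" v] by simp
  next
    case False
    show ?thesis
    proof (cases "a = []")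
      case True
      then show ?thesis using Cons.prems by (metis append_Nil filter.simps(1))
    next
      case False
      with \<open>\<not> (P x \<and> a \<noteq> [])\<close> have "filter P w = a @ b" "\<not> P x" using Cons.prems(2) by auto
      then obtain u v where "w = u @ v" "filter P u = a" "filter P v = b" using Cons.IH by blast
      with \<open>\<not> P x\<close> show ?thesis using Cons.prems(1)[of "x # u" v] by simp
    qed
  qed
qed simp

text \<open>Counting from the end makes the two suffixes comparable, although \<open>w\<close> has
  L-letters in addition: from the bottom of a descent on, \<open>w\<close> and its list of larger
  letters agree.\<close>

lemma no_L_letters_after_descent:
  assumes "avoids_321 w" "d \<in> descents (filter (\<lambda>x. L < x) w)"
  shows "drop (length w - (length (filter (\<lambda>x. L < x) w) - d)) w = drop d (filter (\<lambda>x. L < x) w)"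
proof -
  define xs where "xs = filter (\<lambda>x. L < x) w"
  from assms(2) have d: "1 \<le> d" "d < length xs" "xs ! (d - 1) > xs ! d"
    by (auto simp: descents_def xs_def)
  have "filter (\<lambda>x. L < x) w = take d xs @ xs ! d # drop (Suc d) xs"
    unfolding xs_def[symmetric] using d(2) by (rule id_take_nth_drop)
  then obtain u v0 where 1: "w = u @ v0" "filter (\<lambda>x. L < x) u = take d xs"
      "filter (\<lambda>x. L < x) v0 = xs ! d # drop (Suc d) xs"
    by (rule filter_eq_appendE)
  \<comment> \<open>L-letters may well stand between the top and the bottom of the descent. They
    fall into \<open>u\<close> or \<open>v1\<close>, before the suffix in question.\<close>
  obtain v1 v where 2: "v0 = v1 @ xs ! d # v" "\<forall>x\<in>set v1. \<not> L < x" "L < xs ! d"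
      "drop (Suc d) xs = filter (\<lambda>x. L < x) v"
    using filter_eq_ConsD[OF 1(3)] by (elim exE conjE)
  have "xs ! (d - 1) \<in> set (take d xs)" using d by (auto simp: set_conv_nth intro!: exI[of _ "d - 1"])
  then have "xs ! (d - 1) \<in> set u" using 1(2) by (metis filter_is_subset subsetD)
  then obtain u1 u2 where u: "u = u1 @ xs ! (d - 1) # u2" by (meson split_list)
  have w: "w = u1 @ xs ! (d - 1) # u2 @ v1 @ xs ! d # v"
    using 1(1) 2(1) u by simp
  have "avoids_321 (xs ! (d - 1) # u2 @ v1 @ xs ! d # v)"
    by (rule avoids_321_appendD[OF assms(1)[unfolded w]])
  then have "sorted (filter (\<lambda>y. y < xs ! (d - 1)) (u2 @ v1 @ xs ! d # v))"
    unfolding avoids_321_Cons[of "xs ! (d - 1)"] by (rule conjunct2)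
  then have s: "sorted (filter (\<lambda>y. y < xs ! (d - 1)) (xs ! d # v))"
    unfolding filter_append sorted_append by (elim conjE)
  \<comment> \<open>An L-letter after the descent would complete a 321 pattern.\<close>
  have "\<forall>z\<in>set v. L < z"
  proof (rule ccontr)
    assume "\<not> (\<forall>z\<in>set v. L < z)"
    then obtain z where "z \<in> set v" "z \<le> L" by auto
    with s d(3) 2(3) show False by (auto split: if_splits)
  qed
  then have "v = drop (Suc d) xs" using 2(4) by (simp add: filter_id_conv)
  then have "w = (u @ v1) @ drop d xs"
    using 1(1) 2(1) Cons_nth_drop_Suc[OF d(2)] by simp
  then have "drop (length w - (length xs - d)) w = drop d xs"
    by (metis append_eq_conv_conj diff_diff_cancel length_append length_drop diff_add_inverse2)
  then show ?thesis by (simp add: xs_def)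
qed

section \<open>Words in L- and M-letters and their last run\<close>

definition LM_words :: "nat \<Rightarrow> nat \<Rightarrow> nat list set" where
  "LM_words L m =
     {w \<in> permutations_of_set {1..L+m}. avoids_321 w \<and> sorted (filter (\<lambda>x. x \<le> L) w)}"

abbreviation M_part :: "nat \<Rightarrow> nat list \<Rightarrow> nat list" where
  "M_part L w \<equiv> filter (\<lambda>x. L < x) w"

text \<open>Meaningful only if \<open>M_part L w\<close> has a descent: \<open>Max {}\<close> is unspecified.\<close>

definition last_run :: "nat \<Rightarrow> nat list \<Rightarrow> nat" where
  "last_run L w = length (M_part L w) - Max (descents (M_part L w))"

text \<open>Counted from the right, \<open>k\<close> is the number of inversions that a largest
  letter adds and, if the letter creates a descent, the length of the new last run.\<close>

definition insert_at :: "nat \<Rightarrow> nat \<Rightarrow> nat list \<Rightarrow> nat list" where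
  "insert_at n k w = take (length w - k) w @ n # drop (length w - k) w"

lemma finite_LM_words [simp]: "finite (LM_words L m)"
  by (simp add: LM_words_def)

lemma LM_wordsD:
  assumes "w \<in> LM_words L m"
  shows "set w = {1..L+m}" "distinct w" "length w = L + m" "avoids_321 w"
    "sorted (filter (\<lambda>x. x \<le> L) w)" "length (M_part L w) = m"
proof -
  show 1: "set w = {1..L+m}" "distinct w" "avoids_321 w" "sorted (filter (\<lambda>x. x \<le> L) w)"
    using assms by (auto simp: LM_words_def permutations_of_set_def)
  show "length w = L + m" using distinct_card[OF 1(2)] 1(1) by simp
  have "length (M_part L w) = card (set (M_part L w))"
    using 1(2) by (simp only: distinct_card distinct_filter)
  also have "set (M_part L w) = {L+1..L+m}" using 1(1) by auto
  finally show "length (M_part L w) = m" by simp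
qed

lemma LM_words_insert:
  assumes "set (u @ v) \<subseteq> {1..L+m}"
  shows "u @ Suc (L + m) # v \<in> LM_words L (Suc m) \<longleftrightarrow> u @ v \<in> LM_words L m \<and> sorted v"
proof -
  have "avoids_321 (u @ Suc (L + m) # v) \<longleftrightarrow> avoids_321 (u @ v) \<and> sorted v"
    using assms by (intro avoids_321_insert_greater) auto
  moreover have "set (u @ Suc (L + m) # v) = {1..L+Suc m} \<longleftrightarrow> set (u @ v) = {1..L+m}"
  proof -
    have "{1..L+Suc m} = insert (Suc (L + m)) {1..L+m}" by auto
    moreover have "Suc (L + m) \<notin> set (u @ v)" "Suc (L + m) \<notin> {1..L+m}" using assms by auto
    ultimately show ?thesis
      by (metis Un_insert_right insert_ident list.simps(15) set_append)
  qed
  moreover have "Suc (L + m) \<notin> set (u @ v)" using assms by auto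
  ultimately show ?thesis by (auto simp: LM_words_def permutations_of_set_def)
qed

text \<open>This is \<open>no_L_letters_after_descent\<close> at the last descent: the last run of
  M-letters is a literal suffix of \<open>w\<close>, so positions in \<open>w\<close> and in its
  list of M-letters can be exchanged there.\<close>

lemma LM_words_last_run:
  assumes w: "w \<in> LM_words L m" and ne: "descents (M_part L w) \<noteq> {}"
  shows "last_run L w \<le> m" "1 \<le> last_run L w"
    "drop (L + m - last_run L w) w = drop (m - last_run L w) (M_part L w)"
    "sorted (drop (L + m - last_run L w) w)"
    "\<forall>x\<in>set (drop (L + m - last_run L w) w). L < x"
    "Max (descents (M_part L w)) = m - last_run L w"
proof -
  note W = LM_wordsD[OF w]
  let ?d = "Max (descents (M_part L w))"
  have d: "?d \<in> descents (M_part L w)" using ne by (intro Max_in) auto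
  then have d': "?d < m" using descents_less_length W(6) by metis
  show "last_run L w \<le> m" "1 \<le> last_run L w" "?d = m - last_run L w"
    using d' W(6) by (auto simp: last_run_def)
  moreover have "length (M_part L w) - ?d = last_run L w" by (simp add: last_run_def)
  ultimately show *: "drop (L + m - last_run L w) w = drop (m - last_run L w) (M_part L w)"
    using no_L_letters_after_descent[OF W(4) d] W(3) by simp
  show "sorted (drop (L + m - last_run L w) w)"
    unfolding * using sorted_drop_Max_descents[OF ne] \<open>?d = m - last_run L w\<close> by simp
  show "\<forall>x\<in>set (drop (L + m - last_run L w) w). L < x"
    unfolding * by (auto dest: in_set_dropD)
qed

text \<open>Let \<open>U\<close> and \<open>V\<close> be the M-letters of \<open>u\<close> and
  \<open>v\<close>. Afterwards the descents are those of \<open>U\<close> and the one behind the new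
  letter. If \<open>v\<close> is shorter than the last run, \<open>U\<close> keeps all old descents
  and their number grows by one; if \<open>v\<close> is the whole run, the last old descent lies at
  the cut and is replaced. To end with two descents at least one old descent must survive in
  \<open>U\<close>, which makes the inequality strict for a word that has only one.\<close>

lemma insertion_creates_descent_iff:
  assumes w: "u @ v \<in> LM_words L m" and v: "v \<noteq> []"
  shows "sorted v \<and> 2 \<le> card (descents (M_part L (u @ Suc (L + m) # v))) \<longleftrightarrow>
     (2 \<le> card (descents (M_part L (u @ v))) \<and> length v \<le> last_run L (u @ v)) \<or>
     (card (descents (M_part L (u @ v))) = 1 \<and> length v < last_run L (u @ v))" (is "?lhs \<longleftrightarrow> ?rhs")
    and "sorted v \<Longrightarrow> 2 \<le> card (descents (M_part L (u @ Suc (L + m) # v))) \<Longrightarrow>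
      last_run L (u @ Suc (L + m) # v) = length v"
proof -
  define U V where "U = M_part L u" and "V = M_part L v"
  note W = LM_wordsD[OF w]
  let ?n = "Suc (L + m)"
  have UV: "M_part L (u @ v) = U @ V" "M_part L (u @ ?n # v) = U @ ?n # V"
    by (simp_all add: U_def V_def)
  have lUV: "length U + length V = m" "length u + length v = L + m"
    using W(3,6) by (simp_all add: U_def V_def)
  have less: "\<forall>x\<in>set (U @ V). x < ?n"
  proof
    fix x assume "x \<in> set (U @ V)"
    then have "x \<in> set (u @ v)" by (auto simp: U_def V_def)
    then show "x < ?n" unfolding W(1) by simp
  qed
  have sV: "sorted V" if "sorted v" using that by (simp add: V_def sorted_wrt_filter)
  have des: "descents (U @ ?n # V) = insert (length U + 1) (descents U)" if "sorted v" "V \<noteq> []"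
    using descents_insert_greater[OF sV[OF that(1)] that(2) less] .
  have card_des: "card (descents (U @ ?n # V)) = card (descents U) + 1" if "sorted v" "V \<noteq> []"
  proof -
    have "length U + 1 \<notin> descents U" using descents_less_length by fastforce
    then show ?thesis unfolding des[OF that] by simp
  qed
  have run: "last_run L (u @ ?n # v) = length V" if "sorted v" "V \<noteq> []"
  proof -
    have "Max (insert (length U + 1) (descents U)) = length U + 1"
      by (intro Max_eqI) (auto dest: descents_less_length)
    then show ?thesis unfolding last_run_def UV des[OF that] by simp
  qed
  have sub: "descents U \<subseteq> descents (U @ V)"
    using descents_appendI[of _ U V] descents_less_length by blast
  have vV: "V = v" if "k \<le> m" "drop (L + m - k) (u @ v) = drop (m - k) (U @ V)" "length v \<le> k" for k
  proof -
    have "\<forall>x\<in>set (drop (L + m - k) (u @ v)). L < x"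
      unfolding that(2) by (auto dest: in_set_dropD simp: U_def V_def)
    moreover have "drop (L + m - k) (u @ v) = drop (L + m - k) u @ v"
      using that(3) lUV by simp
    ultimately have "\<forall>x\<in>set v. L < x" by simp
    then show ?thesis by (simp add: V_def filter_id_conv)
  qed
  have fwd: "?rhs \<and> V = v" if "sorted v" "2 \<le> card (descents (U @ ?n # V))"
  proof -
    \<comment> \<open>If \<open>v\<close> had L-letters only, the new letter would create no
      descent. Then \<open>u @ v\<close> would have descents already, hence end with an M-letter,
      but its last letter is in \<open>v\<close>.\<close>
    have Vne: "V \<noteq> []"
    proof
      assume V: "V = []"
      then have "descents (U @ V) \<noteq> {}"
        using that(2) less by (auto simp: descents_snoc_greater)
      note Lr = LM_words_last_run(2,5)[OF w, unfolded UV, OF this]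
      let ?j = "L + m - last_run L (u @ v)"
      have "?j < length (u @ v)" unfolding W(3) using Lr(1) lUV v by (cases v) auto
      then have "drop ?j (u @ v) \<noteq> []" "last (drop ?j (u @ v)) = last v"
        using v by (auto simp: last_drop simp del: drop_append)
      then have "L < last v" using Lr(2) by (metis last_in_set)
      with V v show False by (auto simp: V_def filter_empty_conv)
    qed
    then have "descents U \<noteq> {}" using card_des[OF that(1)] that(2) by auto
    then obtain d where d: "d \<in> descents U" by blast
    then have dU: "d < length U" "d \<in> descents (U @ V)" using sub descents_less_length by blast+
    define k where "k = m - d"
    have k: "k \<le> m" "length V < k" "0 < k" "d = m - k" using dU lUV by (auto simp: k_def)
    have "drop (L + m - (m - d)) (u @ v) = drop d (U @ V)"
      by (rule no_L_letters_after_descent[OF W(4), of d L, unfolded UV W(3) W(6)[unfolded UV]])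
        (rule dU(2))
    then have k2: "drop (L + m - k) (u @ v) = drop (m - k) (U @ V)"
      using k(4) by (metis k_def)
    \<comment> \<open>Otherwise the last \<open>k\<close> letters, all of them M-letters, would lie
      inside \<open>v\<close>; but \<open>V\<close> has fewer than \<open>k\<close> entries because
      the descent \<open>d\<close> lies strictly inside \<open>U\<close>.\<close>
    have "length v \<le> k"
    proof (rule ccontr)
      assume "\<not> length v \<le> k"
      then have "L + m - k = length u + (length v - k)" using lUV by linarith
      then have "drop (L + m - k) (u @ v) = drop (length v - k) v" by simp
      then have "M_part L (drop (length v - k) v) = M_part L (drop (m - k) (U @ V))"
        using k2 by simp
      also have "\<dots> = drop (m - k) (U @ V)"
        unfolding filter_id_conv by (auto simp: U_def V_def simp del: drop_append dest!: in_set_dropD)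
      finally have "M_part L (drop (length v - k) v) = drop (m - k) (U @ V)" .
      then have "k = length (M_part L (drop (length v - k) v))" using lUV k(1) by simp
      also have "\<dots> \<le> length (M_part L v)"
        by (metis append_take_drop_id filter_append length_append le_add2)
      finally show False using k(2) by (simp add: V_def)
    qed
    then have V: "V = v" using vV k k2 by blast
    have ne: "descents (U @ V) \<noteq> {}" using dU by blast
    note Lr = LM_words_last_run[OF w, unfolded UV, OF ne]
    have Max_le: "Max (descents (U @ V)) \<le> length U"
      using ne descents_append_sorted[OF sV[OF that(1)]] by auto
    then have le: "length v \<le> last_run L (u @ v)" using lUV(1)[unfolded V] Lr(1,6) by linarith
    have "?rhs"
    proof (cases "2 \<le> card (descents (U @ V))")
      case False
      moreover have "card (descents (U @ V)) > 0" using ne by (simp add: card_gt_0_iff)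
      ultimately have c1: "card (descents (U @ V)) = 1" by linarith
      then have "descents (U @ V) = {d}" using dU by (auto simp: card_1_singleton_iff)
      then have "length v < last_run L (u @ v)" using Lr(1,6) lUV(1)[unfolded V] dU(1) by auto
      with c1 show ?thesis unfolding UV by simp
    qed (use le in \<open>simp only: UV; simp\<close>)
    with V show ?thesis by simp
  qed
  have bwd: "sorted v \<and> 2 \<le> card (descents (U @ ?n # V))" if r: ?rhs
  proof -
    have ne: "descents (U @ V) \<noteq> {}" using r unfolding UV by auto
    note Lr = LM_words_last_run[OF w, unfolded UV, OF ne]
    have le: "length v \<le> last_run L (u @ v)" using r by auto
    have V: "V = v" using vV[OF Lr(1,3) le] .
    have "drop (L + m - last_run L (u @ v)) (u @ v) = drop (L + m - last_run L (u @ v)) u @ v"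
      using le lUV by simp
    with Lr(4) have "sorted (drop (L + m - last_run L (u @ v)) u @ v)" by (rule subst[rotated])
    then have s: "sorted v" unfolding sorted_append by blast
    \<comment> \<open>If no descent survived, the only old one would be at the cut and
      \<open>v\<close> would be the whole run. This is the combination that the right-hand side
      excludes.\<close>
    have "descents U \<noteq> {}"
    proof
      assume e: "descents U = {}"
      have "i = length U" if "i \<in> descents (U @ V)" for i
        using descents_append_sorted[OF sV[OF s] that] descents_appendI[of i U V] that e
        by (cases "i < length U") auto
      then have eq: "descents (U @ V) = {length U}" using ne by blast
      then have "length U = m - last_run L (u @ v)" unfolding Lr(6)[symmetric] by simp
      then have "last_run L (u @ v) = length v" using lUV(1)[unfolded V] Lr(1) by linarith
      with r eq show False unfolding UV by simp
    qed
    then have "card (descents U) \<ge> 1" by (simp add: Suc_le_eq card_gt_0_iff)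
    with s V v card_des[OF s] show ?thesis by simp
  qed
  show "?lhs \<longleftrightarrow> ?rhs" unfolding UV(2) using fwd bwd by blast
  show "last_run L (u @ Suc (L + m) # v) = length v"
    if "sorted v" "2 \<le> card (descents (M_part L (u @ Suc (L + m) # v)))"
  proof -
    have "sorted v" "V = v" using that(1) fwd[OF that[unfolded UV]] by blast+
    with run v show ?thesis by simp
  qed
qed


section \<open>The recursion in the number of M-letters\<close>

lemma append_Cons_unique:
  assumes "u @ n # v = u' @ n # v'" "n \<notin> set u" "n \<notin> set u'"
  shows "u = u' \<and> v = v'"
proof -
  have "u = takeWhile (\<lambda>x. x \<noteq> n) (u @ n # v)" using assms(2) by (auto simp: takeWhile_append)
  also have "\<dots> = u'" unfolding assms(1) using assms(3) by (auto simp: takeWhile_append)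
  finally show ?thesis using assms(1) by simp
qed

text \<open>Each word with \<open>Suc m\<close> M-letters arises from exactly one pair of a smaller
  word and a place \<open>k\<close>. The weight can be any function of the last run, since
  inversions and last run after the insertion depend only on their old values and on
  \<open>k\<close>.\<close>

lemma LM_words_step:
  fixes L m :: nat and q :: "'a :: comm_ring_1" and f :: "nat \<Rightarrow> 'a :: comm_ring_1"
  defines "D2 \<equiv> \<lambda>m. {w \<in> LM_words L m. 2 \<le> card (descents (M_part L w))}"
    and "D1 \<equiv> \<lambda>m. {w \<in> LM_words L m. card (descents (M_part L w)) = 1}"
  shows "(\<Sum>w\<in>D2 (Suc m). q ^ inversions w * f (last_run L w)) =
    (\<Sum>w\<in>D2 m. q ^ inversions w * (f (Suc (last_run L w)) + (\<Sum>k=1..last_run L w. q ^ k * f k))) +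
    (\<Sum>w\<in>D1 m. q ^ inversions w * (\<Sum>k=1..last_run L w - 1. q ^ k * f k))"
proof -
  let ?n = "Suc (L + m)"
  \<comment> \<open>The admissible places. For a word with one descent both ends are missing:
    \<open>k = 0\<close> adds no descent, and \<open>k = last_run L w\<close> merely replaces the
    old one.\<close>
  define K where "K w = (if 2 \<le> card (descents (M_part L w)) then {0..last_run L w}
     else if card (descents (M_part L w)) = 1 then {1..last_run L w - 1} else {})" for w
  define ins where "ins = (\<lambda>(w, k). insert_at ?n k w)"
  have run_snoc: "last_run L (w @ [?n]) = Suc (last_run L w)"
    and des_snoc: "descents (M_part L (w @ [?n])) = descents (M_part L w)"
    if "w \<in> LM_words L m" "descents (M_part L w) \<noteq> {}" for w
  proof -
    have "\<forall>x\<in>set (M_part L w). x < ?n" using LM_wordsD(1)[OF that(1)] by auto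
    then show des: "descents (M_part L (w @ [?n])) = descents (M_part L w)"
      using descents_snoc_greater by simp
    have "last_run L (w @ [?n]) = Suc m - Max (descents (M_part L w))"
      unfolding last_run_def[of L "w @ [?n]"] des using LM_wordsD(6)[OF that(1)] by simp
    then show "last_run L (w @ [?n]) = Suc (last_run L w)"
      using LM_words_last_run(1,6)[OF that] by simp
  qed
  have K_le: "k \<le> length w" if "w \<in> LM_words L m" "k \<in> K w" for w k
  proof -
    have "descents (M_part L w) \<noteq> {}" using that(2) by (auto simp: K_def split: if_splits)
    from LM_words_last_run(1)[OF that(1) this] LM_wordsD(3)[OF that(1)] that(2)
    show ?thesis by (auto simp: K_def split: if_splits)
  qed
  have key: "insert_at ?n k w \<in> D2 (Suc m) \<longleftrightarrow> k \<in> K w"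
    "k \<in> K w \<Longrightarrow> last_run L (insert_at ?n k w) = (if k = 0 then Suc (last_run L w) else k)"
    if w: "w \<in> LM_words L m" and k: "k \<le> length w" for w k
  proof -
    define u v where "u = take (length w - k) w" and "v = drop (length w - k) w"
    have uv: "w = u @ v" "insert_at ?n k w = u @ ?n # v" "length v = k"
      using k by (auto simp: u_def v_def insert_at_def)
    have uvL: "u @ v \<in> LM_words L m" "set (u @ v) \<subseteq> {1..L+m}"
      using w LM_wordsD(1)[OF w] by (auto simp: uv(1))
    have D2_iff: "insert_at ?n k w \<in> D2 (Suc m) \<longleftrightarrow>
        sorted v \<and> 2 \<le> card (descents (M_part L (u @ ?n # v)))"
      unfolding D2_def uv(2) using LM_words_insert[OF uvL(2)] uvL(1) by auto
    have "(insert_at ?n k w \<in> D2 (Suc m) \<longleftrightarrow> k \<in> K w) \<and>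
      (k \<in> K w \<longrightarrow> last_run L (insert_at ?n k w) = (if k = 0 then Suc (last_run L w) else k))"
    proof (cases "k = 0")
      case True
      then have v: "v = []" "w = u" using uv by auto
      show ?thesis
      proof (cases "descents (M_part L w) = {}")
        case True
        have "\<forall>x\<in>set (M_part L w). x < ?n" using LM_wordsD(1)[OF w] by auto
        then have "descents (M_part L (u @ ?n # v)) = {}" using True v descents_snoc_greater by simp
        with True \<open>k = 0\<close> show ?thesis unfolding D2_iff by (simp add: K_def)
      next
        case False
        have "insert_at ?n k w = w @ [?n]" "u @ ?n # v = w @ [?n]" using uv v by auto
        then show ?thesis
          unfolding D2_iff using run_snoc[OF w False] des_snoc[OF w False] \<open>k = 0\<close> v(1)
          by (auto simp: K_def simp del: filter_append)
      qed
    next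
      case False
      then have "v \<noteq> []" using uv by auto
      note iff = insertion_creates_descent_iff[OF uvL(1) this]
      have "k \<in> K w \<longleftrightarrow> (2 \<le> card (descents (M_part L (u @ v))) \<and> length v \<le> last_run L (u @ v)) \<or>
        (card (descents (M_part L (u @ v))) = 1 \<and> length v < last_run L (u @ v))"
        using False uv(3) by (auto simp: K_def uv(1)) (cases v; auto)
      then have "k \<in> K w \<longleftrightarrow> sorted v \<and> 2 \<le> card (descents (M_part L (u @ ?n # v)))"
        using iff(1) by blast
      then show ?thesis unfolding D2_iff using iff(2) False uv(2,3) by auto
    qed
    then show "insert_at ?n k w \<in> D2 (Suc m) \<longleftrightarrow> k \<in> K w"
      "k \<in> K w \<Longrightarrow> last_run L (insert_at ?n k w) = (if k = 0 then Suc (last_run L w) else k)"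
      by auto
  qed
  have inv: "inversions (insert_at ?n k w) = inversions w + k"
    if w: "w \<in> LM_words L m" and k: "k \<le> length w" for w k
  proof -
    have "\<forall>x\<in>set (take (length w - k) w @ drop (length w - k) w). x < ?n"
      using LM_wordsD(1)[OF w] by simp
    from inversions_insert_greater[OF this] k show ?thesis by (simp add: insert_at_def)
  qed
  have img: "D2 (Suc m) = ins ` (SIGMA w:LM_words L m. K w)"
  proof (intro equalityI subsetI)
    fix w' assume w': "w' \<in> D2 (Suc m)"
    then have w'L: "w' \<in> LM_words L (Suc m)" by (simp add: D2_def)
    then have "?n \<in> set w'" using LM_wordsD(1) by auto
    then obtain u v where uv: "w' = u @ ?n # v" by (meson split_list)
    have "set (u @ v) \<subseteq> {1..L+m}"
    proof
      fix x assume x: "x \<in> set (u @ v)"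
      then have "x \<in> {1..L+Suc m}" using LM_wordsD(1)[OF w'L] uv by auto
      moreover have "x \<noteq> ?n" using x LM_wordsD(2)[OF w'L] uv by auto
      ultimately show "x \<in> {1..L+m}" by auto
    qed
    then have "u @ v \<in> LM_words L m" using LM_words_insert w'L uv by blast
    moreover have "w' = insert_at ?n (length v) (u @ v)" by (simp add: uv insert_at_def)
    ultimately have "u @ v \<in> LM_words L m" "length v \<in> K (u @ v)" "w' = ins (u @ v, length v)"
      using key(1)[of "u @ v" "length v"] w' by (auto simp: ins_def)
    then show "w' \<in> ins ` (SIGMA w:LM_words L m. K w)" by blast
  next
    fix w' assume "w' \<in> ins ` (SIGMA w:LM_words L m. K w)"
    then obtain w k where "w \<in> LM_words L m" "k \<in> K w" "w' = insert_at ?n k w"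
      by (auto simp: ins_def)
    then show "w' \<in> D2 (Suc m)" using key(1) K_le by blast
  qed
  have inj: "inj_on ins (SIGMA w:LM_words L m. K w)"
  proof (rule inj_onI, clarsimp simp: ins_def)
    fix w k w' k'
    assume a: "w \<in> LM_words L m" "k \<in> K w" "w' \<in> LM_words L m" "k' \<in> K w'"
      "insert_at ?n k w = insert_at ?n k' w'"
    have n: "?n \<notin> set w" "?n \<notin> set w'" using LM_wordsD(1) a(1,3) by auto
    have "take (length w - k) w = take (length w' - k') w' \<and> drop (length w - k) w = drop (length w' - k') w'"
      using a(5) n unfolding insert_at_def by (intro append_Cons_unique) (auto dest: in_set_takeD)
    moreover from this have "w = w'" by (metis append_take_drop_id)
    moreover have "length (drop (length w - k) w) = k" "length (drop (length w' - k') w') = k'"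
      using K_le a by simp_all
    ultimately show "w = w' \<and> k = k'" by metis
  qed
  have finK: "finite (K w)" for w by (simp add: K_def)
  have "(\<Sum>w\<in>D2 (Suc m). q ^ inversions w * f (last_run L w)) =
    (\<Sum>(w, k)\<in>(SIGMA w:LM_words L m. K w).
       q ^ inversions w * (q ^ k * f (if k = 0 then Suc (last_run L w) else k)))"
    unfolding img sum.reindex[OF inj]
    by (intro sum.cong) (auto simp: ins_def inv key K_le power_add mult.assoc)
  also have "\<dots> = (\<Sum>w\<in>LM_words L m. q ^ inversions w *
       (\<Sum>k\<in>K w. q ^ k * f (if k = 0 then Suc (last_run L w) else k)))"
    by (subst sum.Sigma[symmetric]) (simp_all add: finK sum_distrib_left)
  also have "\<dots> = (\<Sum>w\<in>LM_words L m.
      (if 2 \<le> card (descents (M_part L w)) then q ^ inversions w *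
        (f (Suc (last_run L w)) + (\<Sum>k=1..last_run L w. q ^ k * f k)) else 0) +
      (if card (descents (M_part L w)) = 1 then q ^ inversions w *
        (\<Sum>k=1..last_run L w - 1. q ^ k * f k) else 0))"
  proof (intro sum.cong refl)
    fix w
    have "(\<Sum>k=0..last_run L w. q ^ k * f (if k = 0 then Suc (last_run L w) else k)) =
        f (Suc (last_run L w)) + (\<Sum>k=1..last_run L w. q ^ k * f k)"
      by (subst sum.atLeast_Suc_atMost) (auto intro!: sum.cong)
    moreover have "(\<Sum>k=1..last_run L w - 1. q ^ k * f (if k = 0 then Suc (last_run L w) else k)) =
        (\<Sum>k=1..last_run L w - 1. q ^ k * f k)"
      by (intro sum.cong) auto
    ultimately show "q ^ inversions w *
       (\<Sum>k\<in>K w. q ^ k * f (if k = 0 then Suc (last_run L w) else k)) =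
      (if 2 \<le> card (descents (M_part L w)) then q ^ inversions w *
        (f (Suc (last_run L w)) + (\<Sum>k=1..last_run L w. q ^ k * f k)) else 0) +
      (if card (descents (M_part L w)) = 1 then q ^ inversions w *
        (\<Sum>k=1..last_run L w - 1. q ^ k * f k) else 0)"
      by (simp add: K_def)
  qed
  also have "\<dots> = (\<Sum>w\<in>D2 m. q ^ inversions w *
        (f (Suc (last_run L w)) + (\<Sum>k=1..last_run L w. q ^ k * f k))) +
      (\<Sum>w\<in>D1 m. q ^ inversions w * (\<Sum>k=1..last_run L w - 1. q ^ k * f k))"
    unfolding D1_def D2_def by (simp only: sum.distrib sum.inter_filter[OF finite_LM_words])
  finally show ?thesis .
qed


section \<open>Gaussian binomial coefficients and shuffles\<close>

text \<open>The q-Pochhammer symbol (q; q)_n, which is the q-factorial times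
  \<open>(1 - q) ^ n\<close>.\<close>

definition qfact :: "'a :: field \<Rightarrow> nat \<Rightarrow> 'a" where
  "qfact q n = (\<Prod>j=1..n. 1 - q ^ j)"

lemma qfact_0 [simp]: "qfact q 0 = 1"
  by (simp add: qfact_def)

lemma qfact_Suc: "qfact q (Suc n) = qfact q n * (1 - q ^ Suc n)"
  by (simp add: qfact_def)

lemma qfact_nonzero:
  assumes "\<forall>n>0. q ^ n \<noteq> 1"
  shows "qfact q n \<noteq> 0"
  using assms by (auto simp: qfact_def)

text \<open>The numerator of \<open>qbinomial\<close> is the upper part of the product
  \<open>qfact q (a + b)\<close>. Writing the upper index as a sum exhibits the symmetry and avoids
  truncated subtraction.\<close>

lemma qbinomial_add:
  assumes "\<forall>n>0. q ^ n \<noteq> 1"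
  shows "qbinomial q (a + b) a = qfact q (a + b) / (qfact q a * qfact q b)"
proof -
  have "(\<Prod>j<a. 1 - q ^ (a + b - j)) * qfact q b = qfact q (a + b)"
  proof (induction a)
    case (Suc a)
    have "(\<Prod>j<Suc a. 1 - q ^ (Suc a + b - j)) = (1 - q ^ Suc (a + b)) * (\<Prod>j<a. 1 - q ^ (a + b - j))"
      by (subst prod.lessThan_Suc_shift) simp
    with Suc show ?case by (simp add: qfact_Suc mult_ac)
  qed simp
  then show ?thesis
    unfolding qbinomial_def qfact_def[of q a, symmetric]
    using qfact_nonzero[OF assms] by (simp add: field_simps)
qed

text \<open>The factor for \<open>j = n\<close> is \<open>1 - q ^ 0\<close>.\<close>

lemma qbinomial_eq_0: "n < k \<Longrightarrow> qbinomial q n k = 0"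
  by (auto simp: qbinomial_def intro!: bexI[of _ n])

lemma qbinomial_0 [simp]: "qbinomial q n 0 = 1"
  by (simp add: qbinomial_def)

lemma qbinomial_self:
  assumes "\<forall>n>0. q ^ n \<noteq> 1"
  shows "qbinomial q n n = 1"
  using qbinomial_add[OF assms, of n 0] qfact_nonzero[OF assms] by simp

lemma qbinomial_symmetric:
  assumes "\<forall>n>0. q ^ n \<noteq> 1"
  shows "qbinomial q (a + b) a = qbinomial q (a + b) b"
  using qbinomial_add[OF assms, of a b] qbinomial_add[OF assms, of b a]
  by (simp add: add.commute mult.commute)

text \<open>The q-Pascal rule that fits subsets split by their largest element: if chosen, it
  exceeds the \<open>m - i\<close> elements left out, whence the power of \<open>q\<close>.\<close>

lemma qbinomial_Suc_Suc:
  assumes q: "\<forall>n>0. q ^ n \<noteq> 1"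
  shows "qbinomial q (Suc m) (Suc i) = qbinomial q m (Suc i) + q ^ (m - i) * qbinomial q m i"
proof (cases "i < m")
  case True
  then obtain b where m: "m = i + Suc b" by (auto simp: less_iff_Suc_add)
  have 1: "qbinomial q (Suc m) (Suc i) = qfact q (i + b) * (1 - q ^ Suc (i + b)) * (1 - q ^ Suc (Suc (i + b))) /
      (qfact q i * (1 - q ^ Suc i) * (qfact q b * (1 - q ^ Suc b)))"
    using qbinomial_add[OF q, of "Suc i" "Suc b"] m by (simp only: add_Suc add_Suc_right qfact_Suc)
  have 2: "qbinomial q m (Suc i) = qfact q (i + b) * (1 - q ^ Suc (i + b)) /
      (qfact q i * (1 - q ^ Suc i) * qfact q b)"
    using qbinomial_add[OF q, of "Suc i" "b"] m by (simp only: add_Suc add_Suc_right qfact_Suc)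
  have 3: "qbinomial q m i = qfact q (i + b) * (1 - q ^ Suc (i + b)) /
      (qfact q i * (qfact q b * (1 - q ^ Suc b)))"
    using qbinomial_add[OF q, of i "Suc b"] m by (simp only: add_Suc add_Suc_right qfact_Suc)
  have nz: "1 - q ^ Suc i \<noteq> 0" "1 - q ^ Suc b \<noteq> 0" using q by (simp_all del: power_Suc)
  \<comment> \<open>For \<open>x = q ^ Suc i\<close> and \<open>y = q ^ Suc b\<close> this is
    \<open>1 - x * y = (1 - y) + y * (1 - x)\<close> over a common denominator.\<close>
  have *: "P * E * ((1 - x * y)) / (F * (1 - x) * (G * (1 - y))) =
     P * E / (F * (1 - x) * G) + y * (P * E / (F * (G * (1 - y))))"
    if "1 - x \<noteq> 0" "1 - y \<noteq> 0" "F \<noteq> 0" "G \<noteq> 0" for P E F G x y :: 'a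
    using that by (simp add: divide_simps) (simp add: algebra_simps)
  have "q ^ Suc (Suc (i + b)) = q ^ Suc i * q ^ Suc b" "m - i = Suc b"
    using m by (simp_all add: power_add)
  then show ?thesis
    unfolding 1 2 3 by (simp only: *[OF nz qfact_nonzero[OF q, of i] qfact_nonzero[OF q, of b]])
next
  case False
  then show ?thesis using qbinomial_eq_0[of m "Suc i" q] qbinomial_self[OF q]
    by (cases "i = m") (auto simp: qbinomial_eq_0)
qed

text \<open>The mirrored q-Pascal rule, obtained by symmetry. It fits shuffles split by their first
  letter: a leading large letter has all \<open>a\<close> small letters behind it.\<close>

lemma qbinomial_Suc_Suc':
  assumes q: "\<forall>n>0. q ^ n \<noteq> 1"
  shows "qbinomial q (Suc (a + b)) a = q ^ a * qbinomial q (a + b) a + (if a = 0 then 0 else qbinomial q (a + b) (a - 1))"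
proof (cases a)
  case (Suc a')
  have "qbinomial q (Suc (a + b)) a = qbinomial q (Suc (a + b)) (Suc b)"
    using qbinomial_symmetric[OF q, of a "Suc b"] by simp
  also have "\<dots> = qbinomial q (a + b) (Suc b) + q ^ a * qbinomial q (a + b) b"
    by (simp add: qbinomial_Suc_Suc[OF q])
  also have "qbinomial q (a + b) b = qbinomial q (a + b) a"
    using qbinomial_symmetric[OF q, of a b] by simp
  also have "qbinomial q (a + b) (Suc b) = qbinomial q (a + b) a'"
    using qbinomial_symmetric[OF q, of a' "Suc b"] Suc by simp
  finally show ?thesis using Suc by simp
qed simp

text \<open>Split by the first letter: a leading \<open>x\<close> is in no inversion, and a leading
  \<open>y\<close> is inverted with every letter of \<open>x # xs\<close> and with none of
  \<open>ys\<close>.\<close>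

lemma sum_inversions_shuffles:
  assumes q: "\<forall>n>0. q ^ n \<noteq> 1"
    and "sorted xs" "sorted ys" "\<forall>x\<in>set xs. \<forall>y\<in>set ys. x < y"
  shows "(\<Sum>zs\<in>shuffles xs ys. q ^ inversions zs) = qbinomial q (length xs + length ys) (length xs)"
  using assms(2-)
proof (induction xs ys rule: shuffles.induct)
  case (1 ys)
  then show ?case by (simp add: inversions_sorted)
next
  case (2 xs)
  then show ?case using inversions_sorted[of xs] qbinomial_self[OF q]
    by (cases xs) (simp_all del: inversions_Cons)
next
  case (3 x xs y ys)
  have "(\<Sum>zs\<in>shuffles (x # xs) (y # ys). q ^ inversions zs) =
     (\<Sum>zs\<in>shuffles xs (y # ys). q ^ inversions (x # zs)) +
     (\<Sum>zs\<in>shuffles (x # xs) ys. q ^ inversions (y # zs))"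
  proof -
    have "x \<noteq> y" using 3(5) by auto
    then show ?thesis
      by (simp only: shuffles.simps, subst sum.union_disjoint)
        (auto simp: sum.reindex inj_on_def simp del: inversions_Cons)
  qed
  also have "(\<Sum>zs\<in>shuffles xs (y # ys). q ^ inversions (x # zs)) =
      (\<Sum>zs\<in>shuffles xs (y # ys). q ^ inversions zs)"
  proof (intro sum.cong refl)
    fix zs assume "zs \<in> shuffles xs (y # ys)"
    then have "set zs = set xs \<union> set (y # ys)" by (rule set_shuffles)
    then have "\<forall>z\<in>set zs. \<not> z < x" using 3(3,5) by (auto simp: not_less less_imp_le)
    then show "q ^ inversions (x # zs) = q ^ inversions zs" by (simp add: filter_False)
  qed
  also have "\<dots> = qbinomial q (length xs + length (y # ys)) (length xs)"
    using 3 by (intro 3(1)) auto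
  also have "(\<Sum>zs\<in>shuffles (x # xs) ys. q ^ inversions (y # zs)) =
      (\<Sum>zs\<in>shuffles (x # xs) ys. q ^ length (x # xs) * q ^ inversions zs)"
  proof (intro sum.cong refl)
    fix zs assume "zs \<in> shuffles (x # xs) ys"
    then have "filter (\<lambda>z. z < y) zs \<in> filter (\<lambda>z. z < y) ` shuffles (x # xs) ys" by blast
    also have "\<dots> = shuffles (filter (\<lambda>z. z < y) (x # xs)) (filter (\<lambda>z. z < y) ys)"
      by (rule filter_shuffles)
    also have "filter (\<lambda>z. z < y) (x # xs) = x # xs" using 3(5) by (auto simp: filter_id_conv)
    also have "filter (\<lambda>z. z < y) ys = []" using 3(4) by (auto simp: filter_empty_conv)
    finally have "filter (\<lambda>z. z < y) zs = x # xs" by simp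
    then show "q ^ inversions (y # zs) = q ^ length (x # xs) * q ^ inversions zs"
      by (simp add: power_add)
  qed
  also have "\<dots> = q ^ length (x # xs) * (\<Sum>zs\<in>shuffles (x # xs) ys. q ^ inversions zs)"
    by (simp add: sum_distrib_left)
  also have "(\<Sum>zs\<in>shuffles (x # xs) ys. q ^ inversions zs) =
     qbinomial q (length (x # xs) + length ys) (length (x # xs))"
    using 3 by (intro 3(2)) auto
  finally show ?case
    using qbinomial_Suc_Suc'[OF q, of "length (x # xs)" "length ys"] by simp
qed

text \<open>The exponent is the number of inversions between two increasing blocks when the letters
  of \<open>S\<close> precede the rest. The induction decides whether the largest element belongs to
  \<open>S\<close>.\<close>

lemma sum_subsets_crossings:
  assumes q: "\<forall>n>0. q ^ n \<noteq> 1"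
  shows "(\<Sum>S | S \<subseteq> {L+1..L+m} \<and> card S = i. q ^ (\<Sum>x\<in>S. card {y \<in> {L+1..L+m} - S. y < x})) =
     qbinomial q m i"
proof (induction m arbitrary: i)
  case 0
  have "{S. S \<subseteq> {L+1..L+0} \<and> card S = i} = (if i = 0 then {{}} else {})"
    by auto
  then show ?case by (simp add: qbinomial_eq_0 del: One_nat_def)
next
  case (Suc m)
  let ?C = "{L+1..L+m}" and ?n = "L + Suc m"
  have C: "{L+1..L+Suc m} = insert ?n ?C" "?n \<notin> ?C" "\<forall>x\<in>?C. x < ?n" by auto
  show ?case
  proof (cases i)
    case 0
    have "{S. S \<subseteq> {L+1..L+Suc m} \<and> card S = 0} = {{}}"
      by (auto dest: finite_subset simp: card_eq_0_iff)
    with 0 show ?thesis by simp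
  next
    case (Suc j)
    have fin: "finite {S. S \<subseteq> ?C \<and> card S = k}" for k
      by (rule finite_subset[of _ "Pow ?C"]) auto
    have split: "{S. S \<subseteq> insert ?n ?C \<and> card S = Suc j} =
       {S. S \<subseteq> ?C \<and> card S = Suc j} \<union> insert ?n ` {S. S \<subseteq> ?C \<and> card S = j}" (is "?A = ?B \<union> ?D")
    proof (intro equalityI subsetI)
      fix S assume S: "S \<in> ?A"
      show "S \<in> ?B \<union> ?D"
      proof (cases "?n \<in> S")
        case True
        have "finite S" using S by (auto intro: finite_subset)
        then have "S - {?n} \<subseteq> ?C \<and> card (S - {?n}) = j" using S True by auto
        moreover have "S = insert ?n (S - {?n})" using True by auto
        ultimately show ?thesis by blast
      qed (use S in auto)
    next
      fix S assume "S \<in> ?B \<union> ?D"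
      then show "S \<in> ?A"
      proof
        assume "S \<in> ?D"
        then obtain S' where S': "S = insert ?n S'" "S' \<subseteq> ?C" "card S' = j" by auto
        then have "finite S'" "?n \<notin> S'" by (auto intro: finite_subset)
        with S' show ?thesis by auto
      qed auto
    qed
    have inj: "inj_on (insert ?n) {S. S \<subseteq> ?C \<and> card S = j}"
    proof (rule inj_onI)
      fix S T assume "S \<in> {S. S \<subseteq> ?C \<and> card S = j}" "T \<in> {S. S \<subseteq> ?C \<and> card S = j}"
        and eq: "insert ?n S = insert ?n T"
      then have "?n \<notin> S" "?n \<notin> T" by auto
      with eq show "S = T" by (simp add: insert_ident)
    qed
    have disj: "{S. S \<subseteq> ?C \<and> card S = Suc j} \<inter> insert ?n ` {S. S \<subseteq> ?C \<and> card S = j} = {}"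
      by auto
    have "(\<Sum>S | S \<subseteq> insert ?n ?C \<and> card S = Suc j. q ^ (\<Sum>x\<in>S. card {y \<in> insert ?n ?C - S. y < x})) =
      (\<Sum>S | S \<subseteq> ?C \<and> card S = Suc j. q ^ (\<Sum>x\<in>S. card {y \<in> insert ?n ?C - S. y < x})) +
      (\<Sum>S | S \<subseteq> ?C \<and> card S = j. q ^ (\<Sum>x\<in>insert ?n S. card {y \<in> insert ?n ?C - insert ?n S. y < x}))"
      by (simp only: split sum.union_disjoint[OF fin finite_imageI[OF fin] disj] sum.reindex[OF inj] o_def)
    also have "(\<Sum>S | S \<subseteq> ?C \<and> card S = Suc j. q ^ (\<Sum>x\<in>S. card {y \<in> insert ?n ?C - S. y < x})) =
        (\<Sum>S | S \<subseteq> ?C \<and> card S = Suc j. q ^ (\<Sum>x\<in>S. card {y \<in> ?C - S. y < x}))"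
      by (intro sum.cong refl arg_cong[of _ _ "power q"] arg_cong[of _ _ card]) auto
    also have "\<dots> = qbinomial q m (Suc j)" by (rule Suc.IH)
    also have "(\<Sum>S | S \<subseteq> ?C \<and> card S = j. q ^ (\<Sum>x\<in>insert ?n S. card {y \<in> insert ?n ?C - insert ?n S. y < x})) =
        (\<Sum>S | S \<subseteq> ?C \<and> card S = j. q ^ (m - j) * q ^ (\<Sum>x\<in>S. card {y \<in> ?C - S. y < x}))"
    proof (intro sum.cong refl)
      fix S assume S: "S \<in> {S. S \<subseteq> ?C \<and> card S = j}"
      then have fS: "finite S" "?n \<notin> S" by (auto intro: finite_subset)
      have "{y \<in> insert ?n ?C - insert ?n S. y < x} = {y \<in> ?C - S. y < x}" for x by auto
      moreover have "{y \<in> ?C - S. y < ?n} = ?C - S" by auto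
      moreover have "card (?C - S) = m - j" using S fS by (subst card_Diff_subset) auto
      ultimately show "q ^ (\<Sum>x\<in>insert ?n S. card {y \<in> insert ?n ?C - insert ?n S. y < x}) =
          q ^ (m - j) * q ^ (\<Sum>x\<in>S. card {y \<in> ?C - S. y < x})"
        using fS by (simp add: power_add)
    qed
    also have "\<dots> = q ^ (m - j) * qbinomial q m j" by (simp only: sum_distrib_left[symmetric] Suc.IH)
    finally show ?thesis unfolding C(1) Suc by (simp add: qbinomial_Suc_Suc[OF q])
  qed
qed


section \<open>Words with exactly one descent\<close>

text \<open>An L-letter has nothing smaller behind it. A larger letter of \<open>u\<close> has
  behind and below it some increasing L-letters, followed by an increasing piece of
  \<open>v\<close>, which lies above them.\<close>

lemma avoids_321_sorted_halves:
  fixes L :: nat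
  assumes "sorted (filter (\<lambda>x. x \<le> L) u)" "sorted (M_part L u)" "sorted v" "\<forall>x\<in>set v. L < x"
  shows "avoids_321 (u @ v)"
  using assms(1,2)
proof (induction u)
  case Nil
  have "sorted v" by fact
  then show ?case by (induction v) (auto simp: avoids_321_Cons sorted_wrt_filter)
next
  case (Cons x u)
  have "sorted (filter (\<lambda>y. y < x) (u @ v))"
  proof (cases "x \<le> L")
    case True
    then have "filter (\<lambda>y. y < x) (u @ v) = []"
      using Cons.prems assms(4) by (fastforce simp: filter_empty_conv)
    then show ?thesis by simp
  next
    case False
    then have "filter (\<lambda>y. y < x) u = filter (\<lambda>x. x \<le> L) u"
      using Cons.prems(2) by (intro filter_cong) auto
    with False Cons.prems assms(3,4) show ?thesis
      by (fastforce simp: sorted_append sorted_wrt_filter)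
  qed
  moreover have "avoids_321 (u @ v)" using Cons by (auto split: if_splits)
  ultimately show ?case by (simp add: avoids_321_Cons)
qed

lemma sorted_if_no_descents: "descents xs = {} \<Longrightarrow> sorted xs"
  unfolding sorted_iff_nth_Suc
proof (intro allI impI, rule ccontr)
  fix i assume e: "descents xs = {}" and i: "Suc i < length xs" "\<not> xs ! i \<le> xs ! Suc i"
  then have "Suc i \<in> descents xs" by (auto simp: descents_def)
  with e show False by simp
qed

lemma descents_sorted: "sorted xs \<Longrightarrow> descents xs = {}"
  using descents_append_sorted[of xs _ "[]"] by (force simp: descents_def)

text \<open>Up to the descent the word shuffles the L-letters with an increasing
  \<open>i\<close>-set \<open>S\<close> of M-letters; the other M-letters follow in increasing
  order, as no L-letter can stand behind the descent. Inversions split into those inside the shuffle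
  and those between \<open>S\<close> and its complement, which gives the two q-binomials.\<close>

lemma sum_one_descent_words:
  fixes g :: "nat \<Rightarrow> 'a :: field"
  assumes q: "\<forall>n>0. q ^ n \<noteq> 1"
  shows "(\<Sum>w | w \<in> LM_words L m \<and> card (descents (M_part L w)) = 1. q ^ inversions w * g (last_run L w)) =
    (\<Sum>i=1..m-1. qbinomial q (L + i) L * (qbinomial q m i - 1) * g (m - i))"
proof -
  let ?C = "{L+1..L+m}"
  define slist where "slist = (sorted_list_of_set :: nat set \<Rightarrow> nat list)"
  have slist: "sorted (slist S)" "distinct (slist S)" "finite S \<Longrightarrow> set (slist S) = S"
    "length (slist S) = card S" for S
    by (simp_all add: slist_def)
  have slist_unique: "xs = slist S" if "sorted xs" "distinct xs" "set xs = S" for xs S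
    using that sorted_distinct_set_unique[of xs "slist S"] slist[of S] by auto
  \<comment> \<open>\<open>S\<close> holds the M-letters before the descent in position \<open>i\<close>; for the excluded set nothing descends there.\<close>
  define I where "I i = {S. S \<subseteq> ?C \<and> card S = i \<and> S \<noteq> {L+1..L+i}}" for i
  define h where "h = (\<lambda>(i::nat, S, u). u @ slist (?C - S))"
  define X where "X = (SIGMA i:{1..m-1}. SIGMA S:I i. shuffles [1..<L+1] (slist S))"
  define D where "D = {w \<in> LM_words L m. card (descents (M_part L w)) = 1}"
  have finS: "finite S" if "S \<in> I i" for S i using that by (auto simp: I_def intro: finite_subset)
  have shuf: "set u = {1..L} \<union> S" "length u = L + i" "filter (\<lambda>x. x \<le> L) u = [1..<L+1]"
      "M_part L u = slist S" "distinct u"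
    if "S \<in> I i" "u \<in> shuffles [1..<L+1] (slist S)" for i S u
  proof -
    have S: "S \<subseteq> ?C" "card S = i" using that(1) by (auto simp: I_def)
    show "set u = {1..L} \<union> S" using set_shuffles[OF that(2)] slist(3)[OF finS[OF that(1)]] by auto
    show "length u = L + i" using length_shuffles[OF that(2)] slist(4) S(2) by simp
    have "filter (\<lambda>x. x \<le> L) [1..<L+1] = [1..<L+1]" "M_part L [1..<L+1] = []"
      by (auto simp: filter_id_conv filter_empty_conv simp del: upt_Suc)
    moreover have "filter (\<lambda>x. x \<le> L) (slist S) = []" "M_part L (slist S) = slist S"
      using S slist(3)[OF finS[OF that(1)]] by (auto simp: filter_id_conv filter_empty_conv)
    moreover have "filter P u \<in> shuffles (filter P [1..<L+1]) (filter P (slist S))" for P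
      using that(2) filter_shuffles by blast
    ultimately show "filter (\<lambda>x. x \<le> L) u = [1..<L+1]" "M_part L u = slist S"
      by (metis shuffles.simps(2) singletonD, metis shuffles.simps(1) singletonD)
    have "set [1..<L+1] \<inter> set (slist S) = {}"
      using S slist(3)[OF finS[OF that(1)]] by auto
    then show "distinct u"
      using distinct_disjoint_shuffles[OF _ slist(2) _ that(2)] by simp
  qed
  have rest: "set (slist (?C - S)) = ?C - S" "length (slist (?C - S)) = m - i" if "S \<in> I i" for S i
  proof -
    show "set (slist (?C - S)) = ?C - S" by (simp add: slist(3))
    show "length (slist (?C - S)) = m - i"
      using that finS[OF that] by (simp add: slist(4) I_def card_Diff_subset)
  qed
  have desc: "descents (slist S @ slist (?C - S)) = {i}" if S: "S \<in> I i" and i: "1 \<le> i" "i \<le> m - 1" for S i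
  proof -
    have len: "length (slist S) = i" using S by (simp add: slist(4) I_def)
    have sub: "descents (slist S @ slist (?C - S)) \<subseteq> {i}"
    proof
      fix j assume j: "j \<in> descents (slist S @ slist (?C - S))"
      then have "j \<le> i" using descents_append_sorted[OF slist(1)] len by blast
      moreover have "\<not> j < i"
        using j descents_appendI[of j "slist S"] descents_sorted[OF slist(1)[of S]] len by auto
      ultimately show "j \<in> {i}" by simp
    qed
    moreover have "descents (slist S @ slist (?C - S)) \<noteq> {}"
    proof
      assume "descents (slist S @ slist (?C - S)) = {}"
      then have "sorted (slist S @ slist (?C - S))" by (rule sorted_if_no_descents)
      moreover have "distinct (slist S @ slist (?C - S))" "set (slist S @ slist (?C - S)) = ?C"
        using rest(1)[OF S] slist(2) slist(3)[OF finS[OF S]] S by (auto simp: I_def)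
      moreover have "sorted [L+1..<L+m+1]" "distinct [L+1..<L+m+1]" "set [L+1..<L+m+1] = ?C"
        by (auto simp del: upt_Suc)
      ultimately have "slist S @ slist (?C - S) = [L+1..<L+m+1]"
        using sorted_distinct_set_unique by metis
      then have "slist S = take i [L+1..<L+m+1]" using len by (metis append_eq_conv_conj)
      also have "\<dots> = [L+1..<L+1+i]" using i by (simp add: take_upt del: upt_Suc)
      finally have "S = set [L+1..<L+1+i]" using slist(3)[OF finS[OF S]] by metis
      then have "S = {L+1..L+i}" by auto
      with S show False by (simp add: I_def)
    qed
    ultimately show ?thesis by blast
  qed
  have h_in: "h (i, S, u) \<in> D" and h_run: "last_run L (h (i, S, u)) = m - i"
    and h_inv: "inversions (h (i, S, u)) = (\<Sum>x\<in>S. card {y \<in> ?C - S. y < x}) + inversions u"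
    if S: "S \<in> I i" and i: "1 \<le> i" "i \<le> m - 1" and u: "u \<in> shuffles [1..<L+1] (slist S)" for i S u
  proof -
    let ?v = "slist (?C - S)"
    note shuf = shuf[OF S u] and rest = rest[OF S]
    have S': "S \<subseteq> ?C" "card S = i" using S by (auto simp: I_def)
    have Mv: "M_part L ?v = ?v" "filter (\<lambda>x. x \<le> L) ?v = []"
      using rest(1) by (auto simp: filter_id_conv filter_empty_conv)
    have M: "M_part L (u @ ?v) = slist S @ ?v" using Mv shuf(4) by simp
    have "set (u @ ?v) = {1..L+m}" using shuf(1) rest(1) S' by auto
    moreover have "distinct (u @ ?v)" using shuf(1,5) rest(1) slist(2) by auto
    moreover have "avoids_321 (u @ ?v)"
      using shuf(3,4) slist(1) rest(1)
      by (intro avoids_321_sorted_halves[of L]) (auto simp del: upt_Suc)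
    moreover have "sorted (filter (\<lambda>x. x \<le> L) (u @ ?v))" using shuf(3) Mv by (simp del: upt_Suc)
    ultimately show "h (i, S, u) \<in> D"
      using desc[OF S i] M by (auto simp: h_def D_def LM_words_def permutations_of_set_def simp del: filter_append)
    have "length (slist S) = i" using slist(4) S' by simp
    then have "length (slist S @ ?v) = m" using rest(2) i by simp
    then show "last_run L (h (i, S, u)) = m - i"
      unfolding h_def last_run_def split M desc[OF S i] by simp
    have "(\<Sum>x\<leftarrow>u. length (filter (\<lambda>y. y < x) ?v)) = (\<Sum>x\<in>set u. length (filter (\<lambda>y. y < x) ?v))"
      using shuf(5) by (rule sum_list_distinct_conv_sum_set)
    also have "\<dots> = (\<Sum>x\<in>set u. card {y \<in> ?C - S. y < x})"
    proof (intro sum.cong refl)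
      fix x
      have "length (filter (\<lambda>y. y < x) ?v) = card (set (filter (\<lambda>y. y < x) ?v))"
        using slist(2) by (simp only: distinct_card distinct_filter)
      then show "length (filter (\<lambda>y. y < x) ?v) = card {y \<in> ?C - S. y < x}"
        unfolding set_filter rest(1) .
    qed
    \<comment> \<open>L-letters lie below the whole tail, so only the M-letters of \<open>u\<close>
      are inverted with it.\<close>
    also have "\<dots> = (\<Sum>x\<in>S. card {y \<in> ?C - S. y < x})"
    proof (rule sum.mono_neutral_right)
      show "finite (set u)" by (rule List.finite_set)
      show "S \<subseteq> set u" using shuf(1) by blast
      show "\<forall>x\<in>set u - S. card {y \<in> ?C - S. y < x} = 0"
      proof
        fix x assume "x \<in> set u - S"
        then have "{y \<in> ?C - S. y < x} = {}" using shuf(1) by auto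
        then show "card {y \<in> ?C - S. y < x} = 0" by (simp only: card.empty)
      qed
    qed
    finally show "inversions (h (i, S, u)) = (\<Sum>x\<in>S. card {y \<in> ?C - S. y < x}) + inversions u"
      by (simp add: h_def inversions_append inversions_sorted slist(1))
  qed
  have inj: "inj_on h X"
  proof (rule inj_onI)
    fix p p' assume a: "p \<in> X" "p' \<in> X" "h p = h p'"
    obtain i S u i' S' u' where p: "p = (i, S, u)" "p' = (i', S', u')" by (cases p; cases p') auto
    have 1: "S \<in> I i" "1 \<le> i" "i \<le> m - 1" "u \<in> shuffles [1..<L+1] (slist S)"
      and 2: "S' \<in> I i'" "1 \<le> i'" "i' \<le> m - 1" "u' \<in> shuffles [1..<L+1] (slist S')"
      using a p by (auto simp: X_def simp del: upt_Suc)
    have "m - i = m - i'" using h_run[OF 1] h_run[OF 2] a(3) p by simp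
    then have "i = i'" using 1 2 by linarith
    then have "length u = length u'" using shuf(2)[OF 1(1,4)] shuf(2)[OF 2(1,4)] by simp
    then have "u = u'" using a(3) p by (simp add: h_def)
    moreover have "{1..L} \<union> S = {1..L} \<union> S'" using shuf(1)[OF 1(1,4)] shuf(1)[OF 2(1,4)] \<open>u = u'\<close> by simp
    moreover have "S \<inter> {1..L} = {}" "S' \<inter> {1..L} = {}" using 1(1) 2(1) by (auto simp: I_def)
    ultimately have "S = S'" by blast
    with \<open>i = i'\<close> \<open>u = u'\<close> p show "p = p'" by simp
  qed
  have img: "D = h ` X"
  proof (intro equalityI subsetI)
    fix w assume "w \<in> D"
    then have w: "w \<in> LM_words L m" and c: "card (descents (M_part L w)) = 1" by (auto simp: D_def)
    note W = LM_wordsD[OF w]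
    have ne: "descents (M_part L w) \<noteq> {}" using c by auto
    note Lr = LM_words_last_run[OF w ne]
    define i where "i = m - last_run L w"
    have di: "descents (M_part L w) = {i}"
      proof -
      from c obtain d where d: "descents (M_part L w) = {d}" by (rule card_1_singletonE)
      with Lr(6) have "d = i" unfolding i_def by simp
      with d show ?thesis by simp
    qed
    then have "i \<in> descents (M_part L w)" by simp
    then have i: "1 \<le> i" "i \<le> m - 1" unfolding descents_def using W(6) by auto
    have Li: "L + m - last_run L w = L + i" using Lr(1) by (simp add: i_def)
    define u v where "u = take (L + i) w" and "v = drop (L + i) w"
    have wuv: "w = u @ v" by (simp add: u_def v_def)
    have v: "v = drop i (M_part L w)" "sorted v" "\<forall>x\<in>set v. L < x"
      using Lr(3,4,5)[unfolded Li, folded i_def v_def] .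
    have Mv: "M_part L v = v" "filter (\<lambda>x. x \<le> L) v = []"
      using v(3) by (auto simp: filter_id_conv filter_empty_conv)
    have Mw: "M_part L w = M_part L u @ v" unfolding wuv using Mv by simp
    have "M_part L u @ drop i (M_part L w) = take i (M_part L w) @ drop i (M_part L w)"
      unfolding append_take_drop_id unfolding v(1)[symmetric] by (rule Mw[symmetric])
    then have Mu: "M_part L u = take i (M_part L w)" by (simp only: append_same_eq)
    have lu: "length (M_part L u) = i" using Mu W(6) i by simp
    have "descents (M_part L u) = {}"
    proof (rule equals0I)
      fix j assume j: "j \<in> descents (M_part L u)"
      then have "j < i" using descents_less_length lu by metis
      moreover have "j \<in> descents (M_part L w)"
        unfolding Mw using j descents_appendI[OF descents_less_length[OF j]] by blast
      ultimately show False unfolding di by simp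
    qed
    then have su: "sorted (M_part L u)" by (rule sorted_if_no_descents)
    define S where "S = set (M_part L u)"
    have dist: "distinct u" "distinct v" "set u \<inter> set v = {}" using W(2) wuv by auto
    have Mu_S: "M_part L u = slist S"
      by (rule slist_unique[OF su _ S_def[symmetric]]) (use dist in simp)
    have "set (M_part L w) = ?C" using W(1) by auto
    then have "set v = ?C - S" "S \<subseteq> ?C" unfolding Mw S_def using dist by auto
    then have v_S: "v = slist (?C - S)" using slist_unique[OF v(2) dist(2)] by blast
    have cardS: "card S = i" using lu slist(4)[of S] Mu_S by simp
    have "filter (\<lambda>x. x \<le> L) w = filter (\<lambda>x. x \<le> L) u" unfolding wuv using Mv by simp
    moreover have "set (filter (\<lambda>x. x \<le> L) w) = {1..L}" using W(1) by auto
    ultimately have "sorted (filter (\<lambda>x. x \<le> L) u)" "set (filter (\<lambda>x. x \<le> L) u) = {1..L}"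
      using W(5) by metis+
    moreover have "sorted [1..<L+1]" "distinct [1..<L+1]" "set [1..<L+1] = {1..L}"
      by (auto simp del: upt_Suc)
    ultimately have Lu: "filter (\<lambda>x. x \<le> L) u = [1..<L+1]"
      using distinct_filter[OF dist(1)] by (metis sorted_distinct_set_unique)
    have "u \<in> shuffles (filter (\<lambda>x. x \<le> L) u) (filter (\<lambda>x. \<not> x \<le> L) u)"
      by (rule partition_in_shuffles)
    then have u_sh: "u \<in> shuffles [1..<L+1] (slist S)" using Lu Mu_S by (simp add: not_le del: upt_Suc)
    have "S \<noteq> {L+1..L+i}"
    proof
      assume Se: "S = {L+1..L+i}"
      have "\<forall>x\<in>set (slist S). \<forall>y\<in>set v. x \<le> y"
        using \<open>set v = ?C - S\<close> slist(3)[of S] Se by auto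
      then have "sorted (M_part L w)" unfolding Mw Mu_S sorted_append using v(2) slist(1) by blast
      with descents_sorted ne show False by blast
    qed
    then have "S \<in> I i" using cardS \<open>S \<subseteq> ?C\<close> by (simp add: I_def)
    then have "(i, S, u) \<in> X" using i u_sh by (simp add: X_def del: upt_Suc)
    moreover have "w = h (i, S, u)" using wuv v_S by (simp add: h_def)
    ultimately show "w \<in> h ` X" by blast
  next
    fix w assume "w \<in> h ` X"
    then obtain i S u where "(i, S, u) \<in> X" "w = h (i, S, u)" by auto
    then show "w \<in> D" using h_in by (auto simp: X_def simp del: upt_Suc)
  qed
  have finI: "finite (I i)" for i by (rule finite_subset[of _ "Pow ?C"]) (auto simp: I_def)
  let ?x = "\<lambda>S. \<Sum>x\<in>S. card {y \<in> ?C - S. y < x}"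
  have "(\<Sum>w\<in>D. q ^ inversions w * g (last_run L w)) =
    (\<Sum>(i, S, u)\<in>X. q ^ ?x S * q ^ inversions u * g (m - i))"
    unfolding img sum.reindex[OF inj]
    by (intro sum.cong) (auto simp: X_def h_run h_inv power_add simp del: upt_Suc)
  also have "\<dots> = (\<Sum>i=1..m-1. \<Sum>S\<in>I i. \<Sum>u\<in>shuffles [1..<L+1] (slist S).
      q ^ ?x S * q ^ inversions u * g (m - i))"
    unfolding X_def using finI by (simp add: sum.Sigma del: upt_Suc)
  also have "\<dots> = (\<Sum>i=1..m-1. qbinomial q (L + i) L * (qbinomial q m i - 1) * g (m - i))"
  proof (intro sum.cong refl)
    fix i assume i: "i \<in> {1..m-1}"
    have inner: "(\<Sum>u\<in>shuffles [1..<L+1] (slist S). q ^ inversions u) = qbinomial q (L + i) L"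
      if S: "S \<in> I i" for S
    proof -
      have "\<forall>x\<in>set [1..<L+1]. \<forall>y\<in>set (slist S). x < y"
        using S slist(3)[OF finS[OF S]] by (auto simp: I_def)
      from sum_inversions_shuffles[OF q _ slist(1) this] show ?thesis
        using S slist(4)[of S] by (simp add: I_def del: upt_Suc)
    qed
    let ?J = "{S. S \<subseteq> ?C \<and> card S = i}"
    \<comment> \<open>The excluded interval has no element of its complement below any of its own.
      Its term is \<open>q ^ 0\<close>, the 1 that is subtracted from
      \<open>qbinomial q m i\<close>.\<close>
    have x0: "?x {L+1..L+i} = 0" by (intro sum.neutral) auto
    have "I i = ?J - {{L+1..L+i}}" by (auto simp: I_def)
    moreover have "{L+1..L+i} \<in> ?J" using i by auto
    moreover have "finite ?J" by (rule finite_subset[of _ "Pow ?C"]) auto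
    ultimately have "(\<Sum>S\<in>I i. q ^ ?x S) = (\<Sum>S\<in>?J. q ^ ?x S) - q ^ ?x {L+1..L+i}"
      by (simp only: sum_diff1 if_True)
    then have outer: "(\<Sum>S\<in>I i. q ^ ?x S) = qbinomial q m i - 1"
      unfolding sum_subsets_crossings[OF q] x0 by simp
    have "(\<Sum>S\<in>I i. \<Sum>u\<in>shuffles [1..<L+1] (slist S). q ^ ?x S * q ^ inversions u * g (m - i)) =
        (\<Sum>S\<in>I i. q ^ ?x S * (qbinomial q (L + i) L * g (m - i)))"
      by (intro sum.cong refl)
        (simp add: inner[symmetric] sum_distrib_left sum_distrib_right mult.assoc del: upt_Suc)
    also have "\<dots> = qbinomial q (L + i) L * (qbinomial q m i - 1) * g (m - i)"
      unfolding sum_distrib_right[symmetric] outer by simp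
    finally show "(\<Sum>S\<in>I i. \<Sum>u\<in>shuffles [1..<L+1] (slist S). q ^ ?x S * q ^ inversions u * g (m - i)) =
       qbinomial q (L + i) L * (qbinomial q m i - 1) * g (m - i)" .
  qed
  finally show ?thesis unfolding D_def .
qed


section \<open>Splitting a word at its leftmost R-letter\<close>

text \<open>Since L-letters are smaller than R-letters, the three order conditions together say that
  all of these letters form one increasing sequence.\<close>

lemma LMR_words_iff:
  "w \<in> LMR_words L M R \<longleftrightarrow> set w = {1..L+M+R} \<and> distinct w \<and> avoids_321 w \<and>
     sorted (filter (\<lambda>x. x \<le> L \<or> L + M < x) w)"
proof -
  have *: "(\<forall>i j. i < j \<and> j < length w \<and> L_letter L (w ! i) \<and> L_letter L (w ! j) \<longrightarrow> w ! i < w ! j)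
      \<and> (\<forall>i j. i < j \<and> j < length w \<and> R_letter L M R (w ! i) \<and> R_letter L M R (w ! j) \<longrightarrow> w ! i < w ! j)
      \<and> (\<forall>i j. i < length w \<and> j < length w \<and> L_letter L (w ! i) \<and> R_letter L M R (w ! j) \<longrightarrow> i < j)
      \<longleftrightarrow> sorted (filter (\<lambda>x. x \<le> L \<or> L + M < x) w)" (is "?A \<and> ?B \<and> ?C \<longleftrightarrow> ?D")
    if w: "set w = {1..L+M+R}" "distinct w"
  proof -
    have range: "w ! i \<in> {1..L+M+R}" if "i < length w" for i
      using w(1) nth_mem[OF that] by simp
    have Lw: "L_letter L (w ! i) \<longleftrightarrow> w ! i \<le> L" if "i < length w" for i
      using range[OF that] by (auto simp: L_letter_def)
    have Rw: "R_letter L M R (w ! i) \<longleftrightarrow> L + M < w ! i" if "i < length w" for i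
      using range[OF that] by (auto simp: R_letter_def)
    show ?thesis
    proof
      assume abc: "?A \<and> ?B \<and> ?C"
      show ?D
        unfolding sorted_wrt_filter_iff_nth
      proof (intro allI impI)
        fix i j
        assume a: "i < j \<and> j < length w \<and> (w ! i \<le> L \<or> L + M < w ! i) \<and> (w ! j \<le> L \<or> L + M < w ! j)"
        then have l: "i < length w" "j < length w" by auto
        consider "w ! i \<le> L" "w ! j \<le> L" | "L + M < w ! i" "L + M < w ! j"
          | "w ! i \<le> L" "L + M < w ! j" | "L + M < w ! i" "w ! j \<le> L" using a by blast
        then show "w ! i \<le> w ! j"
        proof cases
          case 1
          then have "w ! i < w ! j" using abc a l Lw by blast
          then show ?thesis by simp
        next
          case 2
          then have "w ! i < w ! j" using abc a l Rw by blast
          then show ?thesis by simp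
        next
          case 4
          then have "j < i" using abc l Lw Rw by blast
          then show ?thesis using a by simp
        qed simp
      qed
    next
      assume d: ?D
      have srt: "w ! i \<le> w ! j" if "i < j" "j < length w" "w ! i \<le> L \<or> L + M < w ! i"
        "w ! j \<le> L \<or> L + M < w ! j" for i j
        using d that unfolding sorted_wrt_filter_iff_nth by blast
      have ne: "w ! i \<noteq> w ! j" if "i < j" "j < length w" for i j
        using w(2) that by (simp add: nth_eq_iff_index_eq)
      show "?A \<and> ?B \<and> ?C"
      proof (intro conjI allI impI)
        fix i j
        assume a: "i < j \<and> j < length w \<and> L_letter L (w ! i) \<and> L_letter L (w ! j)"
        then have "w ! i \<le> w ! j" using srt[of i j] Lw[of i] Lw[of j] by simp
        then show "w ! i < w ! j" using ne[of i j] a by simp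
      next
        fix i j
        assume a: "i < j \<and> j < length w \<and> R_letter L M R (w ! i) \<and> R_letter L M R (w ! j)"
        then have "w ! i \<le> w ! j" using srt[of i j] Rw[of i] Rw[of j] by simp
        then show "w ! i < w ! j" using ne[of i j] a by simp
      next
        fix i j
        assume a: "i < length w \<and> j < length w \<and> L_letter L (w ! i) \<and> R_letter L M R (w ! j)"
        then have "w ! i \<le> L" "L + M < w ! j" using Lw Rw by auto
        then show "i < j" using srt[of j i] a by (cases i j rule: linorder_cases) auto
      qed
    qed
  qed
  show ?thesis
  proof (cases "set w = {1..L+M+R} \<and> distinct w")
    case True
    then have "w \<in> permutations_of_set {1..L+M+R}" by (simp add: permutations_of_set_def)
    then show ?thesis
      unfolding LMR_words_def mem_Collect_eq *[OF conjunct1[OF True] conjunct2[OF True]]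
      using True by (simp only: simp_thms)
  next
    case False
    then have "w \<notin> permutations_of_set {1..L+M+R}" by (auto simp: permutations_of_set_def)
    then have "w \<notin> LMR_words L M R" by (simp add: LMR_words_def)
    with False show ?thesis by (simp only: simp_thms) blast
  qed
qed

lemma distinct_filter_halves:
  "distinct (filter P xs) \<Longrightarrow> distinct (filter (\<lambda>x. \<not> P x) xs) \<Longrightarrow> distinct xs"
  by (induction xs) (auto split: if_splits)

text \<open>The cut is at the smallest R-letter, which is also the leftmost. Behind it there is no
  L-letter, the M-letters increase because they lie below the cut letter, and the other R-letters
  come in their only possible order. What remains free is a word in L- and M-letters, a suffix of it
  to be moved behind the cut, and a shuffle.\<close>

lemma LMR_words_decomp_iff:
  assumes "R > 0" and P: "\<forall>x\<in>set P. x \<le> L + M"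
  shows "P @ Suc (L + M) # Q \<in> LMR_words L M R \<longleftrightarrow>
    P @ filter (\<lambda>x. x \<le> L + M) Q \<in> LM_words L M \<and> sorted (filter (\<lambda>x. x \<le> L + M) Q) \<and>
    (\<forall>x\<in>set Q. L < x) \<and> filter (\<lambda>x. L + M < x) Q = [L+M+2..<L+M+R+1]" (is "?w \<in> _ \<longleftrightarrow> ?rhs")
proof
  let ?F = "filter (\<lambda>x. x \<le> L \<or> L + M < x)" and ?U = "filter (\<lambda>x. x \<le> L + M) Q"
  assume "?w \<in> LMR_words L M R"
  then have set: "set ?w = {1..L+M+R}" and dist: "distinct ?w" and av: "avoids_321 ?w"
    and srt: "sorted (?F ?w)" by (simp_all only: LMR_words_iff)
  have srtQ: "sorted (Suc (L + M) # ?F Q)" using srt by (simp add: sorted_append)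
  have QL: "\<forall>x\<in>set Q. L < x"
  proof (rule ballI, rule ccontr)
    fix x assume "x \<in> set Q" "\<not> L < x"
    then have "x \<in> set (?F Q)" by simp
    then have "Suc (L + M) \<le> x" using srtQ by (simp only: sorted_simps)
    with \<open>\<not> L < x\<close> show False by simp
  qed
  then have FQ: "?F Q = filter (\<lambda>x. L + M < x) Q" by (intro filter_cong) auto
  have setQ: "set (filter (\<lambda>x. L + M < x) Q) = {L+M+2..L+M+R}"
  proof (intro equalityI subsetI)
    fix x assume x: "x \<in> set (filter (\<lambda>x. L + M < x) Q)"
    then have "x \<in> set ?w" "x \<noteq> Suc (L + M)" using dist by auto
    then have "x \<in> {1..L+M+R}" unfolding set by blast
    then show "x \<in> {L+M+2..L+M+R}" using x \<open>x \<noteq> Suc (L + M)\<close> by auto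
  next
    fix x assume x: "x \<in> {L+M+2..L+M+R}"
    then have "x \<in> set ?w" unfolding set by auto
    moreover have "x \<notin> set P" using P x by auto
    ultimately show "x \<in> set (filter (\<lambda>x. L + M < x) Q)" using x by auto
  qed
  have "filter (\<lambda>x. L + M < x) Q = [L+M+2..<L+M+R+1]"
  proof (rule sorted_distinct_set_unique)
    show "sorted (filter (\<lambda>x. L + M < x) Q)" using srtQ unfolding FQ by simp
    show "distinct (filter (\<lambda>x. L + M < x) Q)" using dist by simp
    show "set (filter (\<lambda>x. L + M < x) Q) = set [L+M+2..<L+M+R+1]" unfolding setQ by auto
  qed (simp_all del: upt_Suc)
  moreover have "sorted ?U"
  proof -
    have "avoids_321 (Suc (L + M) # Q)" using av by (rule avoids_321_appendD)
    then show ?thesis by (simp add: avoids_321_Cons less_Suc_eq_le)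
  qed
  moreover have "P @ ?U \<in> LM_words L M"
  proof -
    have eq: "P @ ?U = filter (\<lambda>x. x \<le> L + M) ?w" using P by (simp add: filter_id_conv)
    have "set (filter (\<lambda>x. x \<le> L + M) ?w) = {1..L+M}" unfolding set_filter set by auto
    moreover have "avoids_321 (filter (\<lambda>x. x \<le> L + M) ?w)" using av by (rule avoids_321_filter)
    moreover have "distinct (filter (\<lambda>x. x \<le> L + M) ?w)" using dist by (rule distinct_filter)
    moreover have "sorted (filter (\<lambda>x. x \<le> L) (filter (\<lambda>x. x \<le> L + M) ?w))"
    proof -
      have "filter (\<lambda>x. x \<le> L) (filter (\<lambda>x. x \<le> L + M) ?w) = filter (\<lambda>x. x \<le> L) (?F ?w)"
        unfolding filter_filter by (intro filter_cong) auto
      then show ?thesis using srt by (simp only: sorted_wrt_filter)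
    qed
    ultimately show ?thesis unfolding eq LM_words_def permutations_of_set_def by blast
  qed
  ultimately show ?rhs using QL by blast
next
  let ?F = "filter (\<lambda>x. x \<le> L \<or> L + M < x)" and ?U = "filter (\<lambda>x. x \<le> L + M) Q"
  assume r: ?rhs
  then have PU: "P @ ?U \<in> LM_words L M" and sU: "sorted ?U" and QL: "\<forall>x\<in>set Q. L < x"
    and V: "filter (\<lambda>x. L + M < x) Q = [L+M+2..<L+M+R+1]" by blast+
  note W = LM_wordsD[OF PU]
  have nle: "filter (\<lambda>x. \<not> x \<le> L + M) Q = [L+M+2..<L+M+R+1]" using V by (simp only: not_le)
  have "set Q = set ?U \<union> set (filter (\<lambda>x. L + M < x) Q)" by auto
  moreover have "set [L+M+2..<L+M+R+1] = {L+M+2..L+M+R}" by (auto simp del: upt_Suc)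
  ultimately have setQ: "set Q = set ?U \<union> {L+M+2..L+M+R}" by (simp only: V)
  have "set ?w = {1..L+M} \<union> {Suc (L + M)} \<union> {L+M+2..L+M+R}"
    unfolding W(1)[symmetric] set_append list.set setQ by blast
  also have "\<dots> = {1..L+M+R}" using \<open>R > 0\<close> by auto
  finally have "set ?w = {1..L+M+R}" .
  moreover have "distinct ?w"
  proof -
    have "distinct Q"
    proof (rule distinct_filter_halves)
      show "distinct ?U" using W(2) by (simp only: distinct_append)
      show "distinct (filter (\<lambda>x. \<not> x \<le> L + M) Q)" unfolding nle by (rule distinct_upt)
    qed
    moreover have "set P \<inter> set Q = {}"
    proof -
      have "set P \<inter> set ?U = {}" using W(2) by (simp only: distinct_append)
      moreover have "set P \<inter> {L+M+2..L+M+R} = {}" using P by auto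
      ultimately show ?thesis unfolding setQ by blast
    qed
    moreover have "Suc (L + M) \<notin> set P" using P by auto
    moreover have "Suc (L + M) \<notin> set Q" unfolding setQ by auto
    moreover have "distinct P" using W(2) by simp
    ultimately show ?thesis by simp
  qed
  moreover have "avoids_321 ?w"
  proof (rule avoids_321_appendI[OF P])
    have U: "filter (\<lambda>x. x \<le> L + M) (Suc (L + M) # Q) = ?U" by simp
    show "avoids_321 (P @ filter (\<lambda>x. x \<le> L + M) (Suc (L + M) # Q))" unfolding U by (rule W(4))
    show "sorted (filter (\<lambda>x. x \<le> L + M) (Suc (L + M) # Q))" unfolding U by (rule sU)
    have "filter (\<lambda>x. \<not> x \<le> L + M) (Suc (L + M) # Q) = Suc (L + M) # [L+M+2..<L+M+R+1]"
      using nle by simp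
    then show "sorted (filter (\<lambda>x. \<not> x \<le> L + M) (Suc (L + M) # Q))" by (auto simp del: upt_Suc)
  qed
  moreover have "sorted (?F ?w)"
  proof -
    have "?F Q = filter (\<lambda>x. L + M < x) Q" using QL by (intro filter_cong) auto
    moreover have "?F P = filter (\<lambda>x. x \<le> L) P" using P by (intro filter_cong) auto
    ultimately have "?F ?w = filter (\<lambda>x. x \<le> L) P @ Suc (L + M) # [L+M+2..<L+M+R+1]"
      using V by simp
    moreover have "sorted (filter (\<lambda>x. x \<le> L) P)" using W(5) by (simp add: sorted_append)
    ultimately show ?thesis by (auto simp: sorted_append simp del: upt_Suc)
  qed
  ultimately show "?w \<in> LMR_words L M R" unfolding LMR_words_iff by blast
qed

lemma LMR_words_split:
  assumes "R > 0" and w: "w \<in> LMR_words L M R"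
  obtains P Q where "w = P @ Suc (L + M) # Q" "\<forall>x\<in>set P. x \<le> L + M"
proof -
  have W: "set w = {1..L+M+R}" "distinct w" "sorted (filter (\<lambda>x. x \<le> L \<or> L + M < x) w)"
    using w by (simp_all only: LMR_words_iff)
  have "Suc (L + M) \<in> set w" unfolding W(1) using \<open>R > 0\<close> by auto
  then obtain P Q where PQ: "w = P @ Suc (L + M) # Q" by (meson split_list)
  have "x \<le> L + M" if x: "x \<in> set P" for x
  proof (rule ccontr)
    assume "\<not> x \<le> L + M"
    then have "x \<le> Suc (L + M)" using W(3) x unfolding PQ by (simp add: sorted_append)
    moreover have "x \<noteq> Suc (L + M)" using W(2) x unfolding PQ by auto
    ultimately show False using \<open>\<not> x \<le> L + M\<close> by simp
  qed
  with PQ that show thesis by blast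
qed

lemma card_positions_less:
  "card {p. p < length w \<and> X (w ! p) \<and> p < n} = length (filter X (take n w))"
  unfolding length_filter_conv_card by (intro arg_cong[of _ _ card]) auto

lemma card_positions_greater:
  "card {p. p < length (u @ a # v) \<and> X ((u @ a # v) ! p) \<and> p > length u} = length (filter X v)"
proof -
  have "{p. p < length (u @ a # v) \<and> X ((u @ a # v) ! p) \<and> p > length u} =
      (\<lambda>i. i + Suc (length u)) ` {i. i < length v \<and> X (v ! i)}"
  proof (intro equalityI subsetI)
    fix p assume p: "p \<in> {p. p < length (u @ a # v) \<and> X ((u @ a # v) ! p) \<and> p > length u}"
    then obtain i where i: "p = length u + Suc i" by (auto dest: less_imp_Suc_add)
    with p have "i < length v" "X (v ! i)" by (auto simp: nth_append)
    then show "p \<in> (\<lambda>i. i + Suc (length u)) ` {i. i < length v \<and> X (v ! i)}"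
      using i by (intro image_eqI[of _ _ i]) auto
  qed (auto simp: nth_append)
  moreover have "inj_on (\<lambda>i. i + Suc (length u)) {i. i < length v \<and> X (v ! i)}"
    by (simp add: inj_on_def)
  ultimately show ?thesis by (simp only: card_image length_filter_conv_card)
qed

text \<open>This matches the counting by rank in \<open>alpha\<close>. The ranks run from 1 to the
  number of letters with \<open>X\<close>, so truncated subtraction is right even if
  \<open>d\<close> exceeds them all.\<close>

lemma card_positions_rank_greater:
  "card {p. p < length P \<and> X (P ! p) \<and> d < length (filter X (take (Suc p) P))} =
     length (filter X P) - d"
proof (induction P rule: rev_induct)
  case (snoc a P)
  define S where "S P = {p. p < length P \<and> X (P ! p) \<and> d < length (filter X (take (Suc p) P))}" for P
  have "S (P @ [a]) = (if X a \<and> d < Suc (length (filter X P)) then insert (length P) (S P) else S P)"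
    by (auto simp: S_def nth_append less_Suc_eq)
  moreover have "length P \<notin> S P" "finite (S P)" by (auto simp: S_def)
  moreover have "card (S P) = length (filter X P) - d" using snoc by (simp add: S_def)
  ultimately have "card (S (P @ [a])) = length (filter X (P @ [a])) - d" by auto
  then show ?case unfolding S_def .
qed simp

section \<open>The statistics of a word cut at its leftmost R-letter\<close>

context
  fixes L M R :: nat and w P Q :: "nat list"
  assumes R: "R > 0" and w: "w = P @ Suc (L + M) # Q" "w \<in> LMR_words L M R"
    and P: "\<forall>x\<in>set P. x \<le> L + M"
begin

private abbreviation "U \<equiv> filter (\<lambda>x. x \<le> L + M) Q"

lemmas LMR_decomp = w(2)[unfolded w(1) LMR_words_decomp_iff[OF R P]]

lemma LMR_letters_range: "x \<in> set w \<Longrightarrow> 1 \<le> x \<and> x \<le> L + M + R"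
  using w(2) unfolding LMR_words_iff by auto

lemma M_letter_P: "filter (M_letter L M) P = M_part L P"
  using P by (intro filter_cong) (auto simp: M_letter_def)

lemma M_letter_Q: "filter (M_letter L M) Q = U"
  using LMR_decomp by (intro filter_cong) (auto simp: M_letter_def)

lemma M_part_U: "M_part L U = U"
proof -
  have "\<forall>x\<in>set Q. L < x" using LMR_decomp by blast
  then show ?thesis unfolding filter_id_conv by simp
qed

lemma M_subword_decomp: "M_subword L M w = M_part L (P @ U)"
  using M_letter_P M_letter_Q M_part_U by (simp add: M_subword_def w(1) M_letter_def)

lemma M_descents_decomp: "M_descents L M w = descents (M_part L (P @ U))"
  unfolding M_descents_def M_subword_decomp descents_def ..

lemma leftmost_R_decomp: "leftmost_R L M R w = length P"
  unfolding leftmost_R_def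
proof (rule Least_equality)
  show "length P < length w \<and> R_letter L M R (w ! length P)"
    using R by (simp add: w(1) R_letter_def)
next
  fix p assume p: "p < length w \<and> R_letter L M R (w ! p)"
  show "length P \<le> p"
  proof (rule ccontr)
    assume "\<not> length P \<le> p"
    then have "w ! p \<in> set P" by (simp add: w(1) nth_append)
    then show False using p P by (force simp: R_letter_def)
  qed
qed

lemma gamma_decomp: "gamma L M R w = length U"
  unfolding gamma_def leftmost_R_decomp unfolding w(1) card_positions_greater M_letter_Q ..

lemma M_letter_right_iff:
  "(\<exists>p < length w. M_letter L M (w ! p) \<and> p > leftmost_R L M R w) \<longleftrightarrow> U \<noteq> []"
proof -
  have "finite {p. p < length w \<and> M_letter L M (w ! p) \<and> p > leftmost_R L M R w}" by simp
  then have "(\<exists>p < length w. M_letter L M (w ! p) \<and> p > leftmost_R L M R w) \<longleftrightarrow> gamma L M R w \<noteq> 0"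
    unfolding gamma_def by (subst card_eq_0_iff) blast
  then show ?thesis unfolding gamma_decomp by simp
qed

lemma alpha_decomp: "alpha L M R w = length (M_part L P) - Max (descents (M_part L (P @ U)))"
proof -
  let ?d = "Max (descents (M_part L (P @ U)))"
  have "alpha L M R w = card {p. p < length P \<and> M_letter L M (P ! p) \<and>
      ?d < length (filter (M_letter L M) (take (Suc p) P))}"
    unfolding alpha_def leftmost_R_decomp M_descents_decomp
    by (intro arg_cong[of _ _ card]) (auto simp: w(1) nth_append M_subword_def)
  then show ?thesis unfolding card_positions_rank_greater M_letter_P .
qed

text \<open>Here \<open>y\<close> is the last M-letter, and \<open>Suc\<close> accounts for the
  R-letter at the cut.\<close>

lemma beta_decomp:
  assumes Q: "Q = V @ y # Z" "y \<le> L + M" "\<forall>z\<in>set Z. L + M < z"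
  shows "beta L M R w = Suc (length (filter (\<lambda>x. L + M < x) V))"
proof -
  have "last_M L M w = length P + Suc (length V)"
    unfolding last_M_def
  proof (rule Greatest_equality)
    have "L < y" using LMR_decomp Q by auto
    then show "length P + Suc (length V) < length w \<and> M_letter L M (w ! (length P + Suc (length V)))"
      using Q by (simp add: w(1) nth_append M_letter_def)
  next
    fix p assume p: "p < length w \<and> M_letter L M (w ! p)"
    show "p \<le> length P + Suc (length V)"
    proof (rule ccontr)
      assume "\<not> p \<le> length P + Suc (length V)"
      then obtain i where i: "p = length (P @ Suc (L + M) # V) + Suc i"
        using less_imp_Suc_add[of "length P + Suc (length V)" p] by auto
      have "w = (P @ Suc (L + M) # V) @ y # Z" by (simp add: w(1) Q(1))
      then have Z: "w ! p = Z ! i" "i < length Z"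
        using p i by (simp_all add: nth_append)
      then have "L + M < w ! p" using Q(3) nth_mem by metis
      then show False using p by (simp add: M_letter_def)
    qed
  qed
  moreover have "take (length P + Suc (length V)) w = P @ Suc (L + M) # V"
    by (simp add: w(1) Q(1))
  ultimately have "beta L M R w = length (filter (R_letter L M R) (P @ Suc (L + M) # V))"
    unfolding beta_def card_positions_less by simp
  also have "filter (R_letter L M R) P = []" using P by (force simp: filter_empty_conv R_letter_def)
  then have "length (filter (R_letter L M R) (P @ Suc (L + M) # V)) =
      Suc (length (filter (R_letter L M R) V))" using R by (simp add: R_letter_def)
  also have "filter (R_letter L M R) V = filter (\<lambda>x. L + M < x) V"
  proof (rule filter_cong[OF refl])
    fix x assume "x \<in> set V"
    then have "x \<le> L + M + R" using LMR_letters_range[of x] by (simp add: w(1) Q(1))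
    then show "R_letter L M R x \<longleftrightarrow> L + M < x" by (auto simp: R_letter_def)
  qed
  finally show ?thesis .
qed

text \<open>No letter of \<open>P\<close> exceeds an R-letter, and the cut letter is inverted with
  exactly the M-letters behind it. As \<open>U\<close> is increasing,
  \<open>inversions (P @ U)\<close> and \<open>inversions Q\<close> count no pair twice.\<close>

lemma inversions_decomp: "inversions w = inversions (P @ U) + length U + inversions Q"
proof -
  have "filter (\<lambda>y. y < x) (Suc (L + M) # Q) = filter (\<lambda>y. y < x) U" if "x \<in> set P" for x
  proof -
    have "x \<le> L + M" using P that by blast
    then show ?thesis by (auto intro: filter_cong)
  qed
  then have "(\<Sum>x\<leftarrow>P. length (filter (\<lambda>y. y < x) (Suc (L + M) # Q))) =
      (\<Sum>x\<leftarrow>P. length (filter (\<lambda>y. y < x) U))"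
    by (intro arg_cong[of _ _ sum_list] map_cong refl) simp
  moreover have "inversions U = 0" using LMR_decomp by (intro inversions_sorted) blast
  moreover have "filter (\<lambda>y. y < Suc (L + M)) Q = U" by (simp only: less_Suc_eq_le)
  ultimately show ?thesis unfolding w(1) inversions_append inversions_Cons by simp
qed

end


section \<open>Generating functions as sums over words without R-letters\<close>

text \<open>Here the R-letters are the increasing tail of the word. They add no inversion, and every
  letter of the last run counts for \<open>alpha\<close>.\<close>

lemma sum_words0:
  fixes q r :: "'a :: field"
  assumes R: "R > 0"
  shows "(\<Sum>w\<in>words0 L M R. q ^ inversions w * r ^ alpha L M R w) =
    (\<Sum>p | p \<in> LM_words L M \<and> 2 \<le> card (descents (M_part L p)). q ^ inversions p * r ^ last_run L p)"
proof -
  let ?Z = "[L+M+2..<L+M+R+1]"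
  define h where "h p = p @ Suc (L + M) # ?Z" for p
  define D where "D = {p \<in> LM_words L M. 2 \<le> card (descents (M_part L p))}"
  have Z: "filter (\<lambda>x. x \<le> L + M) ?Z = []" "filter (\<lambda>x. L + M < x) ?Z = ?Z" "\<forall>x\<in>set ?Z. L < x"
    by (auto simp: filter_empty_conv filter_id_conv simp del: upt_Suc)
  have le: "\<forall>x\<in>set p. x \<le> L + M" if "p \<in> D" for p
    using that LM_wordsD(1) by (auto simp: D_def)
  have h_in: "h p \<in> LMR_words L M R" if "p \<in> D" for p
    unfolding h_def LMR_words_decomp_iff[OF R le[OF that]] Z(1)
    using that Z by (simp add: D_def del: upt_Suc)
  have img: "words0 L M R = h ` D"
  proof (intro equalityI subsetI)
    fix w assume "w \<in> words0 L M R"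
    then have w: "w \<in> LMR_words L M R" "2 \<le> card (M_descents L M w)"
      and nr: "\<not> (\<exists>p < length w. M_letter L M (w ! p) \<and> p > leftmost_R L M R w)"
      by (auto simp: words0_def)
    obtain P Q where PQ: "w = P @ Suc (L + M) # Q" "\<forall>x\<in>set P. x \<le> L + M"
      using LMR_words_split[OF R w(1)] .
    note ctx = R PQ(1) w(1) PQ(2)
    have U: "filter (\<lambda>x. x \<le> L + M) Q = []" using nr M_letter_right_iff[OF ctx] by blast
    then have "filter (\<lambda>x. L + M < x) Q = Q" by (auto simp: filter_empty_conv filter_id_conv)
    then have "Q = ?Z" using LMR_decomp[OF ctx] by metis
    moreover have "P \<in> LM_words L M" using LMR_decomp[OF ctx] unfolding U append_Nil2 by blast
    moreover have "2 \<le> card (descents (M_part L P))"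
      using w(2) unfolding M_descents_decomp[OF ctx] U append_Nil2 .
    ultimately show "w \<in> h ` D" using PQ(1) by (simp add: h_def D_def)
  next
    fix w assume "w \<in> h ` D"
    then obtain p where p: "p \<in> D" "w = h p" by blast
    note ctx = R p(2)[unfolded h_def] h_in[OF p(1), folded p(2)] le[OF p(1)]
    have "2 \<le> card (M_descents L M w)"
      unfolding M_descents_decomp[OF ctx] Z(1) append_Nil2 using p(1) by (simp add: D_def)
    moreover have "\<not> (\<exists>p < length w. M_letter L M (w ! p) \<and> p > leftmost_R L M R w)"
      unfolding M_letter_right_iff[OF ctx] Z(1) by simp
    ultimately show "w \<in> words0 L M R"
      using h_in[OF p(1)] unfolding words0_def p(2) by blast
  qed
  have "inj_on h D" by (simp add: inj_on_def h_def)
  then have "(\<Sum>w\<in>words0 L M R. q ^ inversions w * r ^ alpha L M R w) =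
      (\<Sum>p\<in>D. q ^ inversions (h p) * r ^ alpha L M R (h p))"
    unfolding img by (simp add: sum.reindex)
  also have "\<dots> = (\<Sum>p\<in>D. q ^ inversions p * r ^ last_run L p)"
  proof (intro sum.cong refl)
    fix p assume p: "p \<in> D"
    note ctx = R h_def h_in[OF p] le[OF p]
    have "inversions (h p) = inversions p"
      unfolding inversions_decomp[OF ctx] Z(1) append_Nil2 by (simp add: inversions_sorted del: upt_Suc)
    moreover have "alpha L M R (h p) = last_run L p"
      unfolding alpha_decomp[OF ctx] Z(1) append_Nil2 by (simp add: last_run_def)
    ultimately show "q ^ inversions (h p) * r ^ alpha L M R (h p) = q ^ inversions p * r ^ last_run L p"
      by simp
  qed
  finally show ?thesis unfolding D_def .
qed

lemma sum_list_indicator: "(\<Sum>x\<leftarrow>xs. if P x then 1 else 0 :: nat) = length (filter P xs)"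
  by (induction xs) auto

text \<open>The exponent \<open>b + c - 1\<close> collects the inversions outside the shuffle:
  \<open>c\<close> between the cut letter and the M-letters behind it, and \<open>b - 1\<close>
  between the last M-letter and the other R-letters before it. The last M-letter stays out of the
  shuffle, since its place is what \<open>b\<close> records.\<close>

lemma sum_words1:
  fixes q r s t :: "'a :: field"
  assumes R: "R > 0" and q: "\<forall>n>0. q ^ n \<noteq> 1"
  shows "(\<Sum>w\<in>words1 L M R. q ^ inversions w * r ^ alpha L M R w * s ^ beta L M R w * t ^ gamma L M R w) =
    (\<Sum>p | p \<in> LM_words L M \<and> 2 \<le> card (descents (M_part L p)). q ^ inversions p *
       (\<Sum>c=1..last_run L p. r ^ (last_run L p - c) * t ^ c *
          (\<Sum>b=1..R. s ^ b * q ^ (b + c - 1) * qbinomial q (b + c - 2) (b - 1))))"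
proof -
  define N where "N = L + M"
  define D where "D = {p \<in> LM_words L M. 2 \<le> card (descents (M_part L p))}"
  define U where "U p c = drop (N - c) p" for p :: "nat list" and c
  define Z where "Z b = [N+1+b..<N+R+1]" for b
  define h where "h = (\<lambda>(p, c, b, v). take (N - c) p @ Suc N # v @ last p # Z b)"
  define V where "V p c b = shuffles (butlast (U p c)) [N+2..<N+1+b]" for p c b
  \<comment> \<open>\<open>c\<close> and \<open>b\<close> are the values of gamma and beta; \<open>v\<close> lies strictly between \<open>N + 1\<close> and the last M-letter.\<close>
  define X where "X = (SIGMA p:D. SIGMA c:{1..last_run L p}. SIGMA b:{1..R}. V p c b)"
  note DN = N_def[symmetric]

  have core: "h (p, c, b, v) \<in> words1 L M R \<and> alpha L M R (h (p, c, b, v)) = last_run L p - c \<and>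
      beta L M R (h (p, c, b, v)) = b \<and> gamma L M R (h (p, c, b, v)) = c \<and>
      inversions (h (p, c, b, v)) = inversions p + (b + c - 1) + inversions v \<and>
      filter (\<lambda>x. x \<le> N) (v @ last p # Z b) = U p c \<and> length v = c - 1 + (b - 1)"
    if p: "p \<in> D" and c: "1 \<le> c" "c \<le> last_run L p" and b: "1 \<le> b" "b \<le> R" and v: "v \<in> V p c b"
    for p c b v
  proof -
    let ?P = "take (N - c) p" and ?Q = "v @ last p # Z b"
    have pL: "p \<in> LM_words L M" and d2: "2 \<le> card (descents (M_part L p))" using p by (auto simp: D_def)
    note W = LM_wordsD[OF pL, folded N_def]
    have ne: "descents (M_part L p) \<noteq> {}" using d2 by auto
    note Lr = LM_words_last_run[OF pL ne, folded N_def]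
    have cN: "c \<le> M" "c \<le> N" using c Lr(1) by (simp_all add: N_def)
    have pU: "p = ?P @ U p c" by (simp add: U_def)
    have lenU: "length (U p c) = c" using W(3) cN by (simp add: U_def)
    have "U p c = drop (last_run L p - c) (drop (N - last_run L p) p)"
      using c Lr(1) cN by (simp add: U_def N_def)
    then have sU: "sorted (U p c)" and UL: "\<forall>x\<in>set (U p c). L < x"
      using sorted_wrt_drop[OF Lr(4)] Lr(5) by (metis, metis in_set_dropD)
    have Une: "U p c \<noteq> []" using lenU c by auto
    have lastU: "last (U p c) = last p" using Une by (subst (2) pU) simp
    have bl: "butlast (U p c) @ [last p] = U p c" using Une by (simp add: lastU[symmetric])
    have pN: "\<forall>x\<in>set p. x \<le> N" using W(1) by auto
    have PN: "\<forall>x\<in>set ?P. x \<le> L + M" using pN by (auto simp: N_def dest: in_set_takeD)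
    have UN: "\<forall>x\<in>set (U p c). x \<le> N" using pN by (auto simp: U_def dest: in_set_dropD)
    have lpN: "last p \<le> N" "L < last p" using UN UL lastU last_in_set[OF Une] by metis+
    have blN: "\<forall>x\<in>set (butlast (U p c)). x \<le> N" using UN by (auto dest: in_set_butlastD)
    have filt: "filter P v \<in> shuffles (filter P (butlast (U p c))) (filter P [N+2..<N+1+b])" for P
      using v filter_shuffles unfolding V_def by blast
    have fv: "filter (\<lambda>x. x \<le> N) v = butlast (U p c)" "filter (\<lambda>x. N < x) v = [N+2..<N+1+b]"
    proof -
      have "filter (\<lambda>x. x \<le> N) (butlast (U p c)) = butlast (U p c)"
        "filter (\<lambda>x. N < x) (butlast (U p c)) = []"
        using blN by (auto simp: filter_id_conv filter_empty_conv)
      moreover have "filter (\<lambda>x. x \<le> N) [N+2..<N+1+b] = []"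
        "filter (\<lambda>x. N < x) [N+2..<N+1+b] = [N+2..<N+1+b]"
        by (auto simp: filter_id_conv filter_empty_conv)
      ultimately show "filter (\<lambda>x. x \<le> N) v = butlast (U p c)" "filter (\<lambda>x. N < x) v = [N+2..<N+1+b]"
        using filt[of "\<lambda>x. x \<le> N"] filt[of "\<lambda>x. N < x"] by simp_all
    qed
    have ZN: "\<forall>z\<in>set (Z b). N < z" by (auto simp: Z_def)
    have fZ: "filter (\<lambda>x. x \<le> N) (Z b) = []" "filter (\<lambda>x. N < x) (Z b) = Z b"
      using ZN by (auto simp: filter_id_conv filter_empty_conv)
    have fQ: "filter (\<lambda>x. x \<le> N) ?Q = U p c" using fv fZ lpN bl by simp
    have "filter (\<lambda>x. N < x) ?Q = [N+2..<N+1+b] @ Z b" using fv fZ lpN by simp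
    also have "\<dots> = [N+2..<N+R+1]"
      unfolding Z_def using b upt_add_eq_append[of "N+2" "N+1+b" "R-b"] by (simp del: upt_Suc)
    finally have fQ2: "filter (\<lambda>x. N < x) ?Q = [N+2..<N+R+1]" .
    have QL: "\<forall>x\<in>set ?Q. L < x"
    proof
      fix x assume x: "x \<in> set ?Q"
      show "L < x"
      proof (cases "x \<le> N")
        case True
        with x have "x \<in> set (filter (\<lambda>x. x \<le> N) ?Q)" unfolding set_filter by blast
        then show ?thesis unfolding fQ using UL by blast
      qed (simp add: N_def)
    qed
    have eq: "h (p, c, b, v) = ?P @ Suc (L + M) # ?Q" by (simp add: h_def N_def)
    have hin: "h (p, c, b, v) \<in> LMR_words L M R"
      unfolding eq unfolding LMR_words_decomp_iff[OF R PN] unfolding DN fQ fQ2 pU[symmetric]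
      by (intro conjI pL sU QL refl)
    note ctx = R eq hin PN
    have MP: "length (M_part L ?P) = M - c"
    proof -
      have "M_part L (U p c) = U p c" unfolding filter_id_conv by (rule UL)
      then have "M_part L p = M_part L ?P @ U p c"
        using arg_cong[OF pU, of "M_part L"] by (simp only: filter_append)
      from arg_cong[OF this, of length] show ?thesis
        unfolding W(6) length_append lenU by simp
    qed
    have desc: "M_descents L M (h (p, c, b, v)) = descents (M_part L p)"
      unfolding M_descents_decomp[OF ctx] DN fQ pU[symmetric] ..
    have "(\<exists>i < length (h (p, c, b, v)). M_letter L M (h (p, c, b, v) ! i) \<and>
        i > leftmost_R L M R (h (p, c, b, v)))"
      unfolding M_letter_right_iff[OF ctx] DN fQ by (rule Une)
    then have 1: "h (p, c, b, v) \<in> words1 L M R" using hin d2 desc by (simp add: words1_def)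
    have 2: "alpha L M R (h (p, c, b, v)) = last_run L p - c"
      unfolding alpha_decomp[OF ctx] DN fQ pU[symmetric] MP Lr(6) using Lr(1) c by simp
    have 3: "beta L M R (h (p, c, b, v)) = b"
      using beta_decomp[OF ctx refl lpN(1)[unfolded N_def] ZN[unfolded N_def]] fv(2) b
      by (simp add: N_def del: upt_Suc)
    have 4: "gamma L M R (h (p, c, b, v)) = c"
      unfolding gamma_decomp[OF ctx] DN fQ by (rule lenU)
    \<comment> \<open>Behind \<open>v\<close>, an R-letter of \<open>v\<close> finds only
      \<open>last p\<close> below it, and an M-letter finds nothing. The total is the number
      \<open>b - 1\<close> of R-letters in \<open>v\<close>.\<close>
    have cross: "length (filter (\<lambda>y. y < x) (last p # Z b)) = (if N < x then 1 else 0)"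
      if x: "x \<in> set v" for x
    proof -
      have Zx: "filter (\<lambda>y. y < x) (Z b) = []"
      proof (cases "x \<le> N")
        case True
        then show ?thesis using ZN by (auto simp: filter_empty_conv)
      next
        case False
        then have "x \<in> set (filter (\<lambda>x. N < x) v)" using x by simp
        then show ?thesis unfolding fv(2) by (auto simp: filter_empty_conv Z_def simp del: upt_Suc)
      qed
      show ?thesis
      proof (cases "x \<le> N")
        case True
        with x have "x \<in> set (filter (\<lambda>x. x \<le> N) v)" by simp
        then have "x \<in> set (butlast (U p c))" unfolding fv(1) .
        moreover have "sorted (butlast (U p c) @ [last p])" using sU bl by simp
        ultimately have "x \<le> last p" by (simp add: sorted_append)
        then show ?thesis using True Zx by simp
      qed (use Zx lpN in simp)
    qed
    have "(\<Sum>x\<leftarrow>v. length (filter (\<lambda>y. y < x) (last p # Z b))) = (\<Sum>x\<leftarrow>v. if N < x then 1 else 0)"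
      by (intro arg_cong[of _ _ sum_list] map_cong refl cross)
    also have "\<dots> = b - 1" unfolding sum_list_indicator fv(2) by (simp del: upt_Suc)
    finally have X: "(\<Sum>x\<leftarrow>v. length (filter (\<lambda>y. y < x) (last p # Z b))) = b - 1" .
    have "inversions (last p # Z b) = 0"
      using ZN lpN by (intro inversions_sorted) (auto simp: Z_def simp del: upt_Suc)
    then have "inversions ?Q = inversions v + (b - 1)"
      unfolding inversions_append X by simp
    then have 5: "inversions (h (p, c, b, v)) = inversions p + (b + c - 1) + inversions v"
      unfolding inversions_decomp[OF ctx] DN fQ pU[symmetric] lenU using b by simp
    have "length v = length (butlast (U p c)) + length [N+2..<N+1+b]"
      using v unfolding V_def by (rule length_shuffles)
    then have 6: "length v = c - 1 + (b - 1)" using lenU by (simp del: upt_Suc)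
    show ?thesis using 1 2 3 4 5 6 fQ by blast
  qed

  have img: "words1 L M R = h ` X"
  proof (intro equalityI subsetI)
    fix w assume "w \<in> words1 L M R"
    then have w: "w \<in> LMR_words L M R" "2 \<le> card (M_descents L M w)"
      and ex: "\<exists>p < length w. M_letter L M (w ! p) \<and> p > leftmost_R L M R w"
      by (auto simp: words1_def)
    obtain P Q where PQ: "w = P @ Suc (L + M) # Q" "\<forall>x\<in>set P. x \<le> L + M"
      using LMR_words_split[OF R w(1)] .
    note ctx = R PQ(1) w(1) PQ(2)
    define u where "u = filter (\<lambda>x. x \<le> N) Q"
    note dec = LMR_decomp[OF ctx, folded N_def, folded u_def]
    have une: "u \<noteq> []" using ex unfolding M_letter_right_iff[OF ctx] u_def N_def .
    define p where "p = P @ u"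
    have pL: "p \<in> LM_words L M" and su: "sorted u" and QL: "\<forall>x\<in>set Q. L < x"
      and fQ: "filter (\<lambda>x. N < x) Q = [N+2..<N+R+1]" using dec unfolding p_def by blast+
    have d2: "2 \<le> card (descents (M_part L p))"
      using w(2) unfolding M_descents_decomp[OF ctx, folded N_def, folded u_def] p_def .
    then have pD: "p \<in> D" using pL by (simp add: D_def)
    have ne: "descents (M_part L p) \<noteq> {}" using d2 by auto
    note W = LM_wordsD[OF pL, folded N_def]
    note Lr = LM_words_last_run[OF pL ne, folded N_def]
    define c where "c = length u"
    have Mu: "M_part L u = u"
      unfolding filter_id_conv u_def using QL by simp
    have Mp: "M_part L p = M_part L P @ u" unfolding p_def filter_append Mu ..
    have lenP: "length (M_part L P) + c = M" using W(6) unfolding Mp c_def by simp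
    have "Max (descents (M_part L p)) \<in> descents (M_part L P @ u)"
      unfolding Mp[symmetric] using ne by (intro Max_in) auto
    then have "Max (descents (M_part L p)) \<le> length (M_part L P)"
      by (rule descents_append_sorted[OF su])
    then have c: "1 \<le> c" "c \<le> last_run L p"
      using une lenP Lr(1) unfolding Lr(6) c_def by (auto simp: Suc_le_eq)
    have lenp: "length P = N - c" using W(3) unfolding p_def c_def by simp
    have Pt: "take (N - c) p = P" and Ud: "U p c = u" unfolding U_def p_def using lenp by simp_all
    have "\<exists>x\<in>set Q. x \<le> N" using une unfolding u_def by (auto simp: filter_empty_conv)
    \<comment> \<open>The last letter that is at most \<open>N\<close> ends the part in which M- and
      R-letters mix; behind it only R-letters follow.\<close>
    then obtain v y z where Q: "Q = v @ y # z" and y: "y \<le> N" and zN: "\<forall>x\<in>set z. \<not> x \<le> N"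
      by (rule split_list_last_propE)
    have fz: "filter (\<lambda>x. x \<le> N) z = []" "filter (\<lambda>x. N < x) z = z"
      using zN by (auto simp: filter_id_conv filter_empty_conv)
    have u_eq: "u = filter (\<lambda>x. x \<le> N) v @ [y]" unfolding u_def Q using y fz by simp
    have lastp: "last p = y" unfolding p_def u_eq by simp
    define b where "b = Suc (length (filter (\<lambda>x. N < x) v))"
    have vz: "filter (\<lambda>x. N < x) v @ z = [N+2..<N+R+1]" using fQ unfolding Q using y fz by simp
    have "length (filter (\<lambda>x. N < x) v) + length z = R - 1"
      using arg_cong[OF vz, of length] by (simp del: upt_Suc)
    then have b: "1 \<le> b" "b \<le> R" using R unfolding b_def by simp_all
    have "filter (\<lambda>x. N < x) v = take (b - 1) [N+2..<N+R+1]" "z = drop (b - 1) [N+2..<N+R+1]"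
      unfolding vz[symmetric] b_def by simp_all
    then have fv: "filter (\<lambda>x. N < x) v = [N+2..<N+1+b]" and z: "z = Z b"
      using b unfolding Z_def by (simp_all add: take_upt drop_upt del: upt_Suc)
    have "v \<in> shuffles (filter (\<lambda>x. x \<le> N) v) (filter (\<lambda>x. \<not> x \<le> N) v)"
      by (rule partition_in_shuffles)
    moreover have "filter (\<lambda>x. \<not> x \<le> N) v = [N+2..<N+1+b]" using fv by (simp only: not_le)
    moreover have "filter (\<lambda>x. x \<le> N) v = butlast (U p c)" unfolding Ud u_eq by simp
    ultimately have "v \<in> V p c b" unfolding V_def by simp
    then have "(p, c, b, v) \<in> X" unfolding X_def using pD c b by simp
    moreover have "w = h (p, c, b, v)" unfolding h_def PQ(1) Q using Pt lastp z by (simp add: N_def)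
    ultimately show "w \<in> h ` X" by blast
  next
    fix w assume "w \<in> h ` X"
    then obtain p c b v where "(p, c, b, v) \<in> X" "w = h (p, c, b, v)" by auto
    then show "w \<in> words1 L M R" using core[of p c b v] by (simp add: X_def)
  qed

  have inj: "inj_on h X"
  proof (rule inj_onI)
    fix x x' assume a: "x \<in> X" "x' \<in> X" "h x = h x'"
    obtain p c b v p' c' b' v' where x: "x = (p, c, b, v)" "x' = (p', c', b', v')"
      by (cases x; cases x') auto
    have m: "p \<in> D" "1 \<le> c" "c \<le> last_run L p" "1 \<le> b" "b \<le> R" "v \<in> V p c b"
      and m': "p' \<in> D" "1 \<le> c'" "c' \<le> last_run L p'" "1 \<le> b'" "b' \<le> R" "v' \<in> V p' c' b'"
      using a(1,2) unfolding x X_def by auto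
    note core1 = core[OF m] and core2 = core[OF m']
    have bc: "b = b'" "c = c'" using core1 core2 a(3) unfolding x by metis+
    have notin: "Suc N \<notin> set (take k p'')" if "p'' \<in> D" for k p''
      using that LM_wordsD(1)[of p'' L M] by (auto simp: D_def N_def dest: in_set_takeD)
    have "take (N - c) p @ Suc N # v @ last p # Z b = take (N - c') p' @ Suc N # v' @ last p' # Z b'"
      using a(3) unfolding x h_def by simp
    from append_Cons_unique[OF this notin[OF m(1)] notin[OF m'(1)]]
    have tk: "take (N - c) p = take (N - c') p'"
      and Q: "v @ last p # Z b = v' @ last p' # Z b'" by blast+
    have "U p c = filter (\<lambda>x. x \<le> N) (v @ last p # Z b)" using core1 by simp
    also have "\<dots> = U p' c'" unfolding Q using core2 by simp
    finally have "drop (N - c) p = drop (N - c') p'" unfolding U_def .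
    then have "p = p'" using tk by (metis append_take_drop_id)
    moreover have "length v = length v'" using core1 core2 bc by simp
    then have "v = v'" using Q by simp
    ultimately show "x = x'" using bc x by simp
  qed

  let ?g = "\<lambda>p c b v. q ^ inversions p * (r ^ (last_run L p - c) * t ^ c *
      (s ^ b * q ^ (b + c - 1) * q ^ inversions v))"
  have "(\<Sum>w\<in>words1 L M R. q ^ inversions w * r ^ alpha L M R w * s ^ beta L M R w * t ^ gamma L M R w) =
    (\<Sum>(p, c, b, v)\<in>X. ?g p c b v)"
    unfolding img sum.reindex[OF inj]
  proof (intro sum.cong refl)
    fix x assume "x \<in> X"
    moreover obtain p c b v where x: "x = (p, c, b, v)" by (cases x) auto
    ultimately have m: "p \<in> D" "1 \<le> c" "c \<le> last_run L p" "1 \<le> b" "b \<le> R" "v \<in> V p c b"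
      unfolding x X_def by auto
    from core[OF m] show "((\<lambda>w. q ^ inversions w * r ^ alpha L M R w * s ^ beta L M R w * t ^ gamma L M R w) \<circ> h) x =
        (case x of (p, c, b, v) \<Rightarrow> ?g p c b v)"
      unfolding x by (simp add: power_add mult_ac)
  qed
  also have "\<dots> = (\<Sum>p\<in>D. \<Sum>c=1..last_run L p. \<Sum>b=1..R. \<Sum>v\<in>V p c b. ?g p c b v)"
  proof -
    have "finite D" by (simp add: D_def)
    moreover have "finite (V p c b)" for p c b by (simp add: V_def)
    ultimately show ?thesis unfolding X_def by (simp add: sum.Sigma)
  qed
  also have "\<dots> = (\<Sum>p\<in>D. q ^ inversions p * (\<Sum>c=1..last_run L p. r ^ (last_run L p - c) * t ^ c *
      (\<Sum>b=1..R. s ^ b * q ^ (b + c - 1) * qbinomial q (b + c - 2) (b - 1))))"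
  proof (intro sum.cong refl)
    fix p assume p: "p \<in> D"
    have inner: "(\<Sum>v\<in>V p c b. q ^ inversions v) = qbinomial q (b + c - 2) (b - 1)"
      if c: "c \<in> {1..last_run L p}" and b: "b \<in> {1..R}" for c b
    proof -
      have pL: "p \<in> LM_words L M" and ne: "descents (M_part L p) \<noteq> {}" using p by (auto simp: D_def)
      note W = LM_wordsD[OF pL, folded N_def] and Lr = LM_words_last_run[OF pL ne, folded N_def]
      have "U p c = drop (last_run L p - c) (drop (N - last_run L p) p)"
        using c Lr(1) by (simp add: U_def N_def)
      then have sU: "sorted (U p c)" using sorted_wrt_drop[OF Lr(4)] by metis
      have "length (U p c) = c" using W(3) c Lr(1) by (simp add: U_def N_def)
      have less: "\<forall>x\<in>set (butlast (U p c)). \<forall>y\<in>set [N+2..<N+1+b]. x < y"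
        using W(1) by (fastforce simp: U_def dest!: in_set_butlastD in_set_dropD)
      have "sorted (butlast (U p c))" using sU by (simp add: sorted_butlast)
      then have "(\<Sum>v\<in>V p c b. q ^ inversions v) = qbinomial q ((c - 1) + (b - 1)) (c - 1)"
        unfolding V_def using sum_inversions_shuffles[OF q _ sorted_upt less] \<open>length (U p c) = c\<close> b
        by (simp del: upt_Suc)
      also have "\<dots> = qbinomial q (b + c - 2) (b - 1)"
      proof -
        have "c - 1 + (b - 1) = b + c - 2" using b c by auto
        then show ?thesis using qbinomial_symmetric[OF q, of "c - 1" "b - 1"] by simp
      qed
      finally show ?thesis .
    qed
    show "(\<Sum>c=1..last_run L p. \<Sum>b=1..R. \<Sum>v\<in>V p c b. ?g p c b v) =
      q ^ inversions p * (\<Sum>c=1..last_run L p. r ^ (last_run L p - c) * t ^ c *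
      (\<Sum>b=1..R. s ^ b * q ^ (b + c - 1) * qbinomial q (b + c - 2) (b - 1)))"
      unfolding sum_distrib_left
    proof (intro sum.cong refl)
      fix c b assume cb: "c \<in> {1..last_run L p}" "b \<in> {1..R}"
      show "(\<Sum>v\<in>V p c b. ?g p c b v) = q ^ inversions p * (r ^ (last_run L p - c) * t ^ c *
          (s ^ b * q ^ (b + c - 1) * qbinomial q (b + c - 2) (b - 1)))"
        unfolding inner[OF cb, symmetric] sum_distrib_left ..
    qed
  qed
  finally show ?thesis unfolding D_def .
qed


section \<open>The functional equation\<close>

text \<open>\<open>R_sum R q c s\<close> and \<open>MR_sum R q r s t k\<close> are \<open>H_c(s)\<close> and \<open>f(k)\<close> of the introductory comment.\<close>

definition R_sum :: "nat \<Rightarrow> 'a \<Rightarrow> nat \<Rightarrow> 'a \<Rightarrow> 'a :: field" where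
  "R_sum R q c s = (\<Sum>b=1..R. s ^ b * q ^ (b + c - 1) * qbinomial q (b + c - 2) (b - 1))"

definition MR_sum :: "nat \<Rightarrow> 'a \<Rightarrow> 'a \<Rightarrow> 'a \<Rightarrow> 'a \<Rightarrow> nat \<Rightarrow> 'a :: field" where
  "MR_sum R q r s t k = (\<Sum>c=1..k. r ^ (k - c) * t ^ c * R_sum R q c s)"

text \<open>With a single M-letter behind the cut nothing is left to shuffle. This value becomes the
  factor of \<open>F0\<close> in \<open>E1\<close>.\<close>

lemma R_sum_1:
  assumes "\<forall>n>0. q ^ n \<noteq> 1"
  shows "R_sum R q 1 s = (\<Sum>b=1..R. (q * s) ^ b)"
  unfolding R_sum_def
  by (intro sum.cong refl) (auto simp: qbinomial_self[OF assms] power_mult_distrib)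

text \<open>On the left the coefficient of \<open>s ^ b\<close> is \<open>q ^ (b + c)\<close> times
  a difference of two q-binomials. The q-Pascal rule contracts it to \<open>q ^ (b - 1)\<close>
  times a single one, which is the coefficient in \<open>R_sum R q c (q * s)\<close>.\<close>

lemma R_sum_Suc:
  assumes q: "\<forall>n>0. q ^ n \<noteq> 1" and c: "c \<ge> 1"
  shows "(1 - q * s) * R_sum R q (Suc c) s = R_sum R q c (q * s) - (q * s) ^ Suc R * R_sum R q c 1"
proof -
  \<comment> \<open>A q-analogue of the hockey-stick identity; each further summand is one use of
    the q-Pascal rule.\<close>
  have hockey: "R_sum R q c 1 = (if R = 0 then 0 else q ^ c * qbinomial q (R + c - 1) (R - 1))" for R
  proof (induction R)
    case (Suc R)
    show ?case
    proof (cases R)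
      case 0
      then show ?thesis using c by (simp add: R_sum_def)
    next
      case (Suc R')
      have "R_sum R q c 1 = q ^ c * qbinomial q (R + c - 1) (R - 1)" using Suc.IH Suc by simp
      then have "R_sum (Suc R) q c 1 = q ^ c * qbinomial q (R + c - 1) (R - 1) +
          q ^ (R + c) * qbinomial q (R + c - 1) R"
        by (simp add: R_sum_def)
      also have "\<dots> = q ^ c * (q ^ R * qbinomial q (R + (c - 1)) R + qbinomial q (R + (c - 1)) (R - 1))"
        using c by (simp add: algebra_simps power_add)
      also have "\<dots> = q ^ c * qbinomial q (Suc (R + (c - 1))) R"
        unfolding qbinomial_Suc_Suc'[OF q] using Suc by simp
      finally show ?thesis using c by simp
    qed
  qed (simp add: R_sum_def)
  \<comment> \<open>The boundary term is what telescoping leaves over; \<open>hockey\<close> identifies it with \<open>R_sum R q c 1\<close>.\<close>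
  have step: "(1 - q * s) * R_sum R q (Suc c) s =
      R_sum R q c (q * s) - (if R = 0 then 0 else s ^ Suc R * q ^ (R + c + 1) * qbinomial q (R + c - 1) (R - 1))" for R
  proof (induction R)
    case (Suc R)
    have pascal: "qbinomial q (R + c) R = q ^ R * qbinomial q (R + c - 1) R +
        (if R = 0 then 0 else qbinomial q (R + c - 1) (R - 1))"
      using qbinomial_Suc_Suc'[OF q, of R "c - 1"] c by simp
    have "R_sum (Suc R) q (Suc c) s = R_sum R q (Suc c) s + s ^ Suc R * q ^ (R + c + 1) * qbinomial q (R + c) R"
      by (simp add: R_sum_def)
    then have "(1 - q * s) * R_sum (Suc R) q (Suc c) s =
        (1 - q * s) * R_sum R q (Suc c) s + (1 - q * s) * (s ^ Suc R * q ^ (R + c + 1) * qbinomial q (R + c) R)"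
      by (simp only: distrib_left)
    also have "\<dots> = R_sum R q c (q * s) + s ^ Suc R * q ^ (R + c + 1) * q ^ R * qbinomial q (R + c - 1) R
       - s ^ Suc (Suc R) * q ^ (Suc R + c + 1) * qbinomial q (R + c) R"
      unfolding Suc.IH by (subst pascal, cases "R = 0") (simp_all add: pascal algebra_simps power_add)
    also have "R_sum R q c (q * s) + s ^ Suc R * q ^ (R + c + 1) * q ^ R * qbinomial q (R + c - 1) R =
        R_sum (Suc R) q c (q * s)"
      by (simp add: R_sum_def power_mult_distrib power_add mult_ac)
    finally show ?case by simp
  qed (simp add: R_sum_def)
  show ?thesis unfolding step hockey by (simp add: power_mult_distrib power_add mult_ac)
qed

text \<open>\<open>R_sum_Suc\<close> lowers an index \<open>Suc c\<close> only if
  \<open>c \<ge> 1\<close>, so the first summand is split off; it yields the \<open>F0\<close> part.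
  Shifting \<open>c\<close> in the others releases the factor \<open>t\<close>.\<close>

lemma MR_sum_Suc:
  assumes q: "\<forall>n>0. q ^ n \<noteq> 1" and s: "q * s \<noteq> 1"
  shows "MR_sum R q r s t (Suc k) = t * (\<Sum>b=1..R. (q * s) ^ b) * r ^ k
    - t * (q * s) ^ (R + 1) / (1 - q * s) * MR_sum R q r 1 t k
    + t / (1 - q * s) * MR_sum R q r (q * s) t k"
proof -
  have nz: "1 - q * s \<noteq> 0" using s by simp
  have "MR_sum R q r s t (Suc k) = r ^ k * t * R_sum R q 1 s +
      (\<Sum>c=Suc 1..Suc k. r ^ (Suc k - c) * t ^ c * R_sum R q c s)"
    unfolding MR_sum_def by (subst sum.atLeast_Suc_atMost) simp_all
  also have "(\<Sum>c=Suc 1..Suc k. r ^ (Suc k - c) * t ^ c * R_sum R q c s) =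
      (\<Sum>c=1..k. r ^ (k - c) * t ^ Suc c * R_sum R q (Suc c) s)"
    by (subst sum.shift_bounds_cl_Suc_ivl) simp
  also have "\<dots> = (\<Sum>c=1..k. t / (1 - q * s) * (r ^ (k - c) * t ^ c * R_sum R q c (q * s)) -
       t * (q * s) ^ (R + 1) / (1 - q * s) * (r ^ (k - c) * t ^ c * R_sum R q c 1))"
  proof (intro sum.cong refl)
    fix c assume "c \<in> {1..k}"
    then have R_Suc: "R_sum R q (Suc c) s = (R_sum R q c (q * s) - (q * s) ^ (R + 1) * R_sum R q c 1) / (1 - q * s)"
      using R_sum_Suc[OF q, of c s R] nz by (simp add: field_simps)
    show "r ^ (k - c) * t ^ Suc c * R_sum R q (Suc c) s =
      t / (1 - q * s) * (r ^ (k - c) * t ^ c * R_sum R q c (q * s)) -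
       t * (q * s) ^ (R + 1) / (1 - q * s) * (r ^ (k - c) * t ^ c * R_sum R q c 1)"
      unfolding R_Suc by (simp add: diff_divide_distrib right_diff_distrib mult_ac)
  qed
  also have "\<dots> = t / (1 - q * s) * MR_sum R q r (q * s) t k -
      t * (q * s) ^ (R + 1) / (1 - q * s) * MR_sum R q r 1 t k"
    unfolding MR_sum_def sum_subtractf sum_distrib_left ..
  finally show ?thesis unfolding R_sum_1[OF q] by (simp add: algebra_simps)
qed

text \<open>For fixed \<open>c\<close> the sum over \<open>k\<close> is \<open>q ^ c\<close> times
  the geometric sum of \<open>(q * r) ^ j\<close> over \<open>j \<le> n - c\<close>. The factor
  \<open>q ^ c\<close> replaces \<open>t\<close> by \<open>q * t\<close>, and the two ends of the
  geometric sum put \<open>1\<close> and \<open>q * r\<close> in the place of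
  \<open>r\<close>.\<close>

lemma sum_MR_sum:
  assumes r: "q * r \<noteq> 1"
  shows "(\<Sum>k=1..n. q ^ k * MR_sum R q r s t k) =
    1 / (1 - q * r) * MR_sum R q 1 s (q * t) n - q * r / (1 - q * r) * MR_sum R q (q * r) s (q * t) n"
proof -
  have nz: "1 - q * r \<noteq> 0" using r by simp
  have "(1 - q * r) * (\<Sum>k=1..n. q ^ k * MR_sum R q r s t k) =
      MR_sum R q 1 s (q * t) n - q * r * MR_sum R q (q * r) s (q * t) n"
  proof (induction n)
    case (Suc n)
    have rec: "MR_sum R q \<rho> s \<tau> (Suc n) = \<rho> * MR_sum R q \<rho> s \<tau> n + \<tau> ^ Suc n * R_sum R q (Suc n) s" for \<rho> \<tau>
    proof -
      have "(\<Sum>c=1..n. \<rho> ^ (Suc n - c) * \<tau> ^ c * R_sum R q c s) =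
          (\<Sum>c=1..n. \<rho> * (\<rho> ^ (n - c) * \<tau> ^ c * R_sum R q c s))"
        by (intro sum.cong refl) (simp add: Suc_diff_le)
      then show ?thesis by (simp add: MR_sum_def sum_distrib_left)
    qed
    \<comment> \<open>\<open>MR_sum\<close> is homogeneous of degree \<open>n\<close> in
      \<open>r\<close> and \<open>t\<close> together.\<close>
    have scale: "MR_sum R q (q * r) s (q * t) n = q ^ n * MR_sum R q r s t n" for n
      unfolding MR_sum_def sum_distrib_left
    proof (intro sum.cong refl)
      fix c assume "c \<in> {1..n}"
      then have "q ^ n = q ^ (n - c) * q ^ c" by (simp add: power_add[symmetric])
      then show "(q * r) ^ (n - c) * (q * t) ^ c * R_sum R q c s = q ^ n * (r ^ (n - c) * t ^ c * R_sum R q c s)"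
        by (simp add: power_mult_distrib)
    qed
    have "(1 - q * r) * (\<Sum>k=1..Suc n. q ^ k * MR_sum R q r s t k) =
        (1 - q * r) * (\<Sum>k=1..n. q ^ k * MR_sum R q r s t k) + (1 - q * r) * MR_sum R q (q * r) s (q * t) (Suc n)"
      by (simp add: distrib_left scale)
    also have "\<dots> = MR_sum R q 1 s (q * t) n - q * r * MR_sum R q (q * r) s (q * t) n +
       (1 - q * r) * MR_sum R q (q * r) s (q * t) (Suc n)"
      unfolding Suc.IH ..
    also have "\<dots> = MR_sum R q 1 s (q * t) (Suc n) - q * r * MR_sum R q (q * r) s (q * t) (Suc n)"
      unfolding rec by (simp add: algebra_simps)
    finally show ?case .
  qed (simp add: MR_sum_def)
  then have "(\<Sum>k=1..n. q ^ k * MR_sum R q r s t k) =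
      (MR_sum R q 1 s (q * t) n - q * r * MR_sum R q (q * r) s (q * t) n) / (1 - q * r)"
    using nz by (simp add: field_simps)
  then show ?thesis by (simp add: diff_divide_distrib)
qed

theorem theorem4p5:
  fixes L R :: nat and q r s t :: "'a :: field"
  assumes "L > 0" and "R > 0"
    and "\<forall>n>0. q ^ n \<noteq> 1" and "q * r \<noteq> 1" and "q * s \<noteq> 1"
  shows "F1 L R q r s t =
      E1 L R q r s t
    + fps_X * fps_const (1 / (1 - q * r)) * F1 L R q 1 s (q * t)
    - fps_X * fps_const (q * r / (1 - q * r)) * F1 L R q (q * r) s (q * t)
    - fps_X * fps_const (t * (q * s) ^ (R + 1) / (1 - q * s)) * F1 L R q r 1 t
    + fps_X * fps_const (t / (1 - q * s)) * F1 L R q r (q * s) t"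
proof (rule fps_ext)
  fix n
  note q = \<open>\<forall>n>0. q ^ n \<noteq> 1\<close>
  define D where "D m = {p \<in> LM_words L m. 2 \<le> card (descents (M_part L p))}" for m
  \<comment> \<open>\<open>F1\<close> and \<open>F0\<close> have constant coefficient 0 by
    convention. The empty \<open>D 0\<close> agrees with this, so one formula covers all
    coefficients.\<close>
  have D0: "D 0 = {}"
  proof -
    have "descents (M_part L p) = {}" if "p \<in> LM_words L 0" for p
      using LM_wordsD(6)[OF that] by (simp add: descents_def)
    then show ?thesis by (auto simp: D_def)
  qed
  have nth_F1: "fps_nth (F1 L R q r s t) M = (\<Sum>p\<in>D M. q ^ inversions p * MR_sum R q r s t (last_run L p))"
    for M and r s t :: 'a
  proof (cases "M \<ge> 1")
    case True
    then show ?thesis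
      unfolding F1_def fps_nth_Abs_fps D_def MR_sum_def R_sum_def
      using sum_words1[OF \<open>R > 0\<close> q] by simp
  qed (simp add: F1_def D0 not_le)
  have nth_F0: "fps_nth (F0 L R q r) M = (\<Sum>p\<in>D M. q ^ inversions p * r ^ last_run L p)" for M
  proof (cases "M \<ge> 1")
    case True
    then show ?thesis
      unfolding F0_def fps_nth_Abs_fps D_def using sum_words0[OF \<open>R > 0\<close>] by simp
  qed (simp add: F0_def D0 not_le)
  let ?rhs = "E1 L R q r s t
    + fps_X * fps_const (1 / (1 - q * r)) * F1 L R q 1 s (q * t)
    - fps_X * fps_const (q * r / (1 - q * r)) * F1 L R q (q * r) s (q * t)
    - fps_X * fps_const (t * (q * s) ^ (R + 1) / (1 - q * s)) * F1 L R q r 1 t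
    + fps_X * fps_const (t / (1 - q * s)) * F1 L R q r (q * s) t"
  show "fps_nth (F1 L R q r s t) n = fps_nth ?rhs n"
  proof (cases n)
    case 0
    then show ?thesis by (simp add: nth_F1 D0 E1_def mult.assoc)
  next
    case (Suc m)
    let ?f = "MR_sum R q r s t"
    let ?E = "\<Sum>i=1..m-1. qbinomial q (L + i) L * (qbinomial q m i - 1) *
        (\<Sum>k=1..m-i-1. \<Sum>c=1..k. \<Sum>b=1..R.
            q ^ (k + b + c - 1) * r ^ (k - c) * s ^ b * t ^ c * qbinomial q (b + c - 2) (b - 1))"
    \<comment> \<open>A word whose only descent is \<open>i\<close> has last run
      \<open>m - i\<close>; this is where the range of \<open>k\<close> in \<open>E1\<close> comes
      from.\<close>
    have E: "(\<Sum>w | w \<in> LM_words L m \<and> card (descents (M_part L w)) = 1.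
        q ^ inversions w * (\<Sum>k=1..last_run L w - 1. q ^ k * ?f k)) = ?E"
      unfolding sum_one_descent_words[OF q, where g = "\<lambda>k. \<Sum>k=1..k - 1. q ^ k * ?f k"]
    proof (intro sum.cong refl arg_cong2[of _ _ _ _ "(*)"])
      fix i k assume "k \<in> {1..m - i - 1}"
      show "q ^ k * ?f k = (\<Sum>c=1..k. \<Sum>b=1..R.
            q ^ (k + b + c - 1) * r ^ (k - c) * s ^ b * t ^ c * qbinomial q (b + c - 2) (b - 1))"
        unfolding MR_sum_def R_sum_def sum_distrib_left
      proof (intro sum.cong refl)
        fix c b assume "c \<in> {1..k}" "b \<in> {1..R}"
        then have "q ^ (k + b + c - 1) = q ^ k * q ^ (b + c - 1)"
          by (simp add: power_add[symmetric] add.assoc)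
        then show "q ^ k * (r ^ (k - c) * t ^ c * (s ^ b * q ^ (b + c - 1) * qbinomial q (b + c - 2) (b - 1))) =
          q ^ (k + b + c - 1) * r ^ (k - c) * s ^ b * t ^ c * qbinomial q (b + c - 2) (b - 1)"
          by (simp only: mult_ac)
      qed
    qed
    have "fps_nth (F1 L R q r s t) n =
      (\<Sum>p\<in>D m. q ^ inversions p * (?f (Suc (last_run L p)) + (\<Sum>k=1..last_run L p. q ^ k * ?f k))) + ?E"
      unfolding nth_F1 Suc D_def LM_words_step E ..
    \<comment> \<open>Every term is a sum over the same set \<open>D m\<close>, so the identity is
      checked for each word separately.\<close>
    also have "(\<Sum>p\<in>D m. q ^ inversions p * (?f (Suc (last_run L p)) + (\<Sum>k=1..last_run L p. q ^ k * ?f k))) =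
       t * (\<Sum>b=1..R. (q * s) ^ b) * fps_nth (F0 L R q r) m
       - t * (q * s) ^ (R + 1) / (1 - q * s) * fps_nth (F1 L R q r 1 t) m
       + t / (1 - q * s) * fps_nth (F1 L R q r (q * s) t) m
       + 1 / (1 - q * r) * fps_nth (F1 L R q 1 s (q * t)) m
       - q * r / (1 - q * r) * fps_nth (F1 L R q (q * r) s (q * t)) m"
      unfolding nth_F1 nth_F0 sum_distrib_left sum_subtractf[symmetric] sum.distrib[symmetric]
        MR_sum_Suc[OF q \<open>q * s \<noteq> 1\<close>] sum_MR_sum[OF \<open>q * r \<noteq> 1\<close>]
      by (intro sum.cong refl) (simp add: distrib_left right_diff_distrib mult_ac)
    also have "\<dots> + ?E = fps_nth ?rhs n"
      unfolding Suc E1_def by (simp add: mult.assoc)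
    finally show ?thesis .
  qed
qed

end
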